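(* Let $f(s)=\sum_{n} a_n e^{\lambda_n s}$, with $a_n\in\mathbb{C}$ and $\lambda_n\in\mathbb{R}$, be a series that converges uniformly in a half-plane $\Re(s)>b$, and suppose that its sum admits an analytic continuation to $\mathbb{C}$ as a nonconstant meromorphic function of finite order. Suppose that $f(s)$ tends to a nonzero finite limit as $\Re(s)\to+\infty$. Then $$\limsup_{r\to+\infty}\frac{N(r,0;f)+N(r,\infty;f)}{r}>0.$$
   Context: Here $s=\sigma+it$ is a complex variable. For a function $f$ meromorphic in $\mathbb{C}$ and $a\in\mathbb{C}\cup\{\infty\}$, $n(r,a;f)$ denotes the number of solutions of $f(s)=a$ (poles when $a=\infty$) in the closed disc $|s|\le r$, counted with multiplicity, and $$N(r,a;f)=\int_0^r\frac{n(t,a;f)-n(0,a;f)}{t}\,dt+n(0,a;f)\log r.$$ The order of a meromorphic function is its order in the sense of Nevanlinna theory (growth order of the Nevanlinna characteristic). *)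

theory Defs
  imports "HOL-Complex_Analysis.Complex_Analysis"
begin

text \<open>Meromorphic functions on the whole plane are represented by functions
  F with F nicely_meromorphic_on UNIV (the canonical representative: removable
  singularities removed, value 0 at poles).\<close>

definition count_a :: "(complex \<Rightarrow> complex) \<Rightarrow> complex \<Rightarrow> real \<Rightarrow> real" where
  "count_a F a r = (\<Sum>z\<in>{z. norm z \<le> r \<and> \<not> is_pole F z \<and> F z = a}.
                        real_of_int (zorder (\<lambda>w. F w - a) z))"

definition count_poles :: "(complex \<Rightarrow> complex) \<Rightarrow> real \<Rightarrow> real" where
  "count_poles F r = (\<Sum>z\<in>{z. norm z \<le> r \<and> is_pole F z}.
                        real_of_int (- zorder F z))"

definition integrated_counting :: "(real \<Rightarrow> real) \<Rightarrow> real \<Rightarrow> real" where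
  "integrated_counting n r = integral {0..r} (\<lambda>t. (n t - n 0) / t) + n 0 * ln r"

definition N_a :: "(complex \<Rightarrow> complex) \<Rightarrow> complex \<Rightarrow> real \<Rightarrow> real" where
  "N_a F a r = integrated_counting (count_a F a) r"

definition N_poles :: "(complex \<Rightarrow> complex) \<Rightarrow> real \<Rightarrow> real" where
  "N_poles F r = integrated_counting (count_poles F) r"

definition proximity :: "(complex \<Rightarrow> complex) \<Rightarrow> real \<Rightarrow> real" where
  "proximity F r = integral {0..2*pi} (\<lambda>\<theta>. max 0 (ln (norm (F (of_real r * cis \<theta>))))) / (2*pi)"

definition nevanlinna_T :: "(complex \<Rightarrow> complex) \<Rightarrow> real \<Rightarrow> real" where
  "nevanlinna_T F r = proximity F r + N_poles F r"

definition nevanlinna_order :: "(complex \<Rightarrow> complex) \<Rightarrow> ereal" where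
  "nevanlinna_order F = Limsup at_top (\<lambda>r. ereal (max 0 (ln (nevanlinna_T F r)) / ln r))"

end

theory Submission
  imports Defs
begin

text \<open>Suppose that the limsup is not positive, so that the number of zeros and poles in the disc of
radius \<open>r\<close> is \<open>o(r)\<close>. On a right half-plane let \<open>l = log (F / c)\<close> and \<open>H = l\<^sup>(\<^sup>k\<^sup>)\<close> with \<open>k\<close> large
compared with the order of \<open>F\<close>. Factor \<open>F\<close> on a disc of radius \<open>R\<close> as a finite Blaschke quotient
times \<open>exp g\<close>. The Schwarz formula and the finite order give \<open>g\<^sup>(\<^sup>k\<^sup>) = O(1 / R)\<close> on the half disc, so up to
small errors \<open>H(s)\<close> is \<open>\<Sum> const / (s - \<rho>)\<^sup>k\<close> over the zeros and poles \<open>\<rho>\<close> with \<open>|\<rho>| < R\<close>. Each term has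
bounded integral over a vertical line, hence with \<open>R\<close> comparable to \<open>T\<close> the integral of \<open>|H|\<close> over a
vertical segment of length \<open>T\<close> is \<open>o(T)\<close>. But \<open>f\<close>, and with it \<open>l\<close> and \<open>H\<close>, is almost periodic in the
vertical direction, which forces \<open>H = 0\<close>. As \<open>l\<close> tends to \<open>0\<close> to the right, \<open>l = 0\<close> and \<open>F\<close> is
constant.\<close>

subsection \<open>Almost periodicity\<close>

text \<open>Pigeonhole on a torus. Cover the unit circle by finitely many balls of radius
  \<open>\<epsilon>/2\<close> and record, for each \<tau>, a nearby ball centre for each phase
  \<open>lam n * \<tau>\<close> with \<open>n < M\<close>. Finitely many records occur and
  \<open>S\<close> holds one real per record, so every \<tau> is a common almost period up to an
  element of \<open>S\<close>.\<close>

lemma finite_almost_periods: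
  fixes lam :: "nat \<Rightarrow> real" and M :: nat and \<epsilon> :: real
  assumes "\<epsilon> > 0"
  obtains S :: "real set" where "finite S"
    "\<And>\<tau>. \<exists>\<sigma>\<in>S. \<forall>n<M. norm (cis (lam n * (\<tau> - \<sigma>)) - 1) < \<epsilon>"
proof -
  have "compact (sphere (0::complex) 1)" by simp
  then obtain C where C: "finite C" "sphere (0::complex) 1 \<subseteq> (\<Union>x\<in>C. ball x (\<epsilon>/2))"
    using compact_imp_seq_compact seq_compact_imp_totally_bounded assms by (metis half_gt_zero)
  have "\<forall>x. \<exists>y\<in>C. dist y (cis x) < \<epsilon>/2"
    using C(2) by (auto simp: subset_iff)
  then obtain q where q: "\<And>x. q x \<in> C" "\<And>x. dist (q x) (cis x) < \<epsilon>/2"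
    by metis
  \<comment> \<open>\<open>restrict\<close> makes each record an element of a finite function
    space.\<close>
  define Q where "Q = (\<lambda>\<tau>. restrict (\<lambda>n. q (lam n * \<tau>)) {..<M})"
  have "range Q \<subseteq> PiE {..<M} (\<lambda>_. C)"
    using q(1) unfolding Q_def by (intro image_subsetI) (auto intro!: PiE_I)
  hence fin: "finite (range Q)"
    using finite_PiE[of "{..<M}" "\<lambda>_. C"] C(1) finite_subset by blast
  define S where "S = inv Q ` range Q"
  show ?thesis
  proof
    show "finite S" unfolding S_def using fin by blast
    fix \<tau> :: real
    define \<sigma> where "\<sigma> = inv Q (Q \<tau>)"
    have Q: "Q \<sigma> = Q \<tau>" unfolding \<sigma>_def by (simp add: f_inv_into_f)
    have "norm (cis (lam n * (\<tau> - \<sigma>)) - 1) < \<epsilon>" if n: "n < M" for n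
    proof -
      have eq: "q (lam n * \<sigma>) = q (lam n * \<tau>)"
        using fun_cong[OF Q, of n] n by (simp add: Q_def)
      have "dist (cis (lam n * \<tau>)) (cis (lam n * \<sigma>)) < \<epsilon>"
        using q(2)[of "lam n * \<sigma>"] q(2)[of "lam n * \<tau>"] eq
        by (metis dist_commute dist_triangle_half_l)
      moreover have "cis (lam n * \<tau>) - cis (lam n * \<sigma>)
          = cis (lam n * \<sigma>) * (cis (lam n * (\<tau> - \<sigma>)) - 1)"
        by (simp add: algebra_simps cis_mult)
      ultimately show ?thesis by (simp add: dist_norm norm_mult)
    qed
    thus "\<exists>\<sigma>\<in>S. \<forall>n<M. norm (cis (lam n * (\<tau> - \<sigma>)) - 1) < \<epsilon>"
      unfolding S_def \<sigma>_def by blast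
  qed
qed

text \<open>One partial sum is within \<open>\<epsilon>/3\<close> of \<open>f\<close> on the whole
  half-plane, which vertical shifts preserve, and \<open>finite_almost_periods\<close> handles its
  finitely many frequencies. The bound \<open>B\<close> keeps the factors
  \<open>exp (lam n * Re s)\<close> bounded when \<open>lam n > 0\<close>.\<close>

lemma almost_periodic_strip:
  fixes a :: "nat \<Rightarrow> complex" and lam :: "nat \<Rightarrow> real" and f :: "complex \<Rightarrow> complex"
  assumes unif: "uniform_limit {s. Re s > b}
                   (\<lambda>M s. \<Sum>n<M. a n * exp (of_real (lam n) * s)) f sequentially"
    and "\<epsilon> > 0"
  obtains S :: "real set" where "finite S"
    "\<And>\<tau>. \<exists>\<sigma>\<in>S. \<forall>s. b < Re s \<longrightarrow> Re s \<le> B \<longrightarrow>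
        norm (f (s + \<i> * of_real (\<tau> - \<sigma>)) - f s) < \<epsilon>"
proof -
  define P where "P = (\<lambda>M s. \<Sum>n<M. a n * exp (of_real (lam n) * s))"
  have "\<forall>\<^sub>F M in sequentially. \<forall>s\<in>{s. Re s > b}. dist (P M s) (f s) < \<epsilon>/3"
    unfolding P_def using uniform_limitD[OF unif, of "\<epsilon>/3"] \<open>\<epsilon> > 0\<close> by simp
  then obtain M where M: "\<And>s. Re s > b \<Longrightarrow> dist (P M s) (f s) < \<epsilon>/3"
    by (auto simp: eventually_sequentially)
  \<comment> \<open>Bounds the sum of the moduli of the terms on the strip, since
    \<open>exp (lam n * x)\<close> is largest at an end of the interval from \<open>b\<close> to
    \<open>B\<close>. The added 1 keeps the divisor positive.\<close>
  define D where "D = (\<Sum>n<M. norm (a n) * exp (max (lam n * b) (lam n * B))) + 1"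
  have D: "D > 0" unfolding D_def by (intro add_nonneg_pos sum_nonneg) auto
  obtain S where S: "finite S"
    "\<And>\<tau>. \<exists>\<sigma>\<in>S. \<forall>n<M. norm (cis (lam n * (\<tau> - \<sigma>)) - 1) < \<epsilon> / (3 * D)"
    using finite_almost_periods[of "\<epsilon> / (3*D)" M lam] D \<open>\<epsilon> > 0\<close> by auto
  show ?thesis
  proof
    show "finite S" by fact
    fix \<tau> :: real
    obtain \<sigma> where \<sigma>: "\<sigma> \<in> S" "\<forall>n<M. norm (cis (lam n * (\<tau> - \<sigma>)) - 1) < \<epsilon> / (3 * D)"
      using S(2) by blast
    have "norm (f (s + \<i> * of_real (\<tau> - \<sigma>)) - f s) < \<epsilon>" if s: "b < Re s" "Re s \<le> B" for s
    proof -
      define s' where "s' = s + \<i> * of_real (\<tau> - \<sigma>)"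
      have "P M s' - P M s = (\<Sum>n<M. a n * exp (of_real (lam n) * s) * (cis (lam n * (\<tau> - \<sigma>)) - 1))"
        unfolding P_def s'_def sum_subtractf[symmetric]
        by (intro sum.cong refl) (simp add: cis_conv_exp algebra_simps exp_add[symmetric] of_real_diff exp_diff)
      hence "norm (P M s' - P M s) \<le> (\<Sum>n<M. norm (a n) * exp (lam n * Re s) * norm (cis (lam n * (\<tau> - \<sigma>)) - 1))"
        by (simp add: norm_mult order_trans[OF norm_sum])
      also have "\<dots> \<le> (\<Sum>n<M. norm (a n) * exp (max (lam n * b) (lam n * B)) * (\<epsilon> / (3 * D)))"
      proof (intro sum_mono mult_mono mult_nonneg_nonneg)
        fix n assume n: "n \<in> {..<M}"
        have "lam n * Re s \<le> max (lam n * b) (lam n * B)"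
          using s by (cases "lam n \<ge> 0") (auto simp: le_max_iff_disj mult_left_mono mult_left_mono_neg)
        thus "exp (lam n * Re s) \<le> exp (max (lam n * b) (lam n * B))" by simp
        show "norm (cis (lam n * (\<tau> - \<sigma>)) - 1) \<le> \<epsilon> / (3 * D)" using \<sigma> n by (simp add: less_imp_le)
      qed auto
      also have "\<dots> = (D - 1) * (\<epsilon> / (3 * D))"
        unfolding sum_distrib_right[symmetric] by (simp add: D_def)
      also have "\<dots> \<le> D * (\<epsilon> / (3 * D))" using D \<open>\<epsilon> > 0\<close> by (intro mult_right_mono) auto
      also have "\<dots> = \<epsilon> / 3" using D by simp
      finally have 1: "norm (P M s' - P M s) \<le> \<epsilon> / 3" .
      have "Re s' > b" using s by (simp add: s'_def)
      hence 2: "norm (P M s' - f s') < \<epsilon> / 3" using M by (simp add: dist_norm)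
      have 3: "norm (P M s - f s) < \<epsilon> / 3" using M s by (simp add: dist_norm)
      have "norm (f s' - f s) = norm ((P M s' - P M s) - (P M s' - f s') + (P M s - f s))" by simp
      also have "\<dots> \<le> norm ((P M s' - P M s) - (P M s' - f s')) + norm (P M s - f s)"
        by (rule norm_triangle_ineq)
      also have "\<dots> \<le> norm (P M s' - P M s) + norm (P M s' - f s') + norm (P M s - f s)"
        by (intro add_right_mono norm_triangle_ineq4)
      finally show ?thesis using 1 2 3 unfolding s'_def by linarith
    qed
    thus "\<exists>\<sigma>\<in>S. \<forall>s. b < Re s \<longrightarrow> Re s \<le> B \<longrightarrow> norm (f (s + \<i> * of_real (\<tau> - \<sigma>)) - f s) < \<epsilon>"
      using \<sigma>(1) by blast
  qed
qed

text \<open>The derivative \<open>inverse\<close> of \<open>Ln\<close> is at most 2 in modulus on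
  this ball, which is convex and stays away from the branch cut.\<close>

lemma Ln_Lipschitz_near_1:
  assumes "w \<in> ball 1 (1/2)" "z \<in> ball 1 (1/2)"
  shows "norm (Ln w - Ln z) \<le> 2 * norm (w - z)"
proof (rule field_differentiable_bound[of "ball 1 (1/2)" Ln inverse 2])
  fix u :: complex assume "u \<in> ball 1 (1/2)"
  hence u: "norm (1 - u) < 1/2" by (simp add: dist_norm)
  hence "Re (1 - u) < 1/2" using complex_Re_le_cmod[of "1 - u"] by linarith
  hence "u \<notin> \<real>\<^sub>\<le>\<^sub>0" by (simp add: complex_nonpos_Reals_iff)
  thus "(Ln has_field_derivative inverse u) (at u within ball 1 (1/2))"
    by (rule has_field_derivative_at_within[OF has_field_derivative_Ln])
  have "norm u \<ge> 1/2" using u norm_triangle_ineq2[of 1 "1-u"] by simp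
  thus "norm (inverse u) \<le> 2" using le_imp_inverse_le[of "1/2" "norm u"] by (simp add: norm_inverse)
qed (use assms in auto)

text \<open>Almost periodicity is assumed of \<open>l\<close> alone; Cauchy's estimate on the unit
  disc about \<open>s0\<close> carries it over to the derivative, which is why the strip reaches one
  unit beyond \<open>s0\<close> on both sides. A nonzero value at \<open>s0\<close> would then recur
  too often for the vertical means to be small.\<close>

lemma higher_deriv_almost_periodic_mean_zero:
  fixes l :: "complex \<Rightarrow> complex"
  assumes l: "l holomorphic_on {s. Re s > \<sigma>}"
    and ap: "\<And>\<epsilon>. \<epsilon> > 0 \<Longrightarrow> \<exists>S. finite S \<and> (\<forall>\<tau>. \<exists>\<nu>\<in>S. \<forall>s. \<sigma> < Re s \<longrightarrow> Re s \<le> Re s0 + 1 \<longrightarrow>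
          norm (l (s + \<i> * of_real (\<tau> - \<nu>)) - l s) \<le> \<epsilon>)"
    and mean: "\<And>\<eta> s1. \<eta> > 0 \<Longrightarrow> Re s1 = Re s0 \<Longrightarrow>
       eventually (\<lambda>T. integral {0..T} (\<lambda>\<tau>. norm ((deriv ^^ k) l (s1 + \<i> * of_real \<tau>))) \<le> \<eta> * T) at_top"
    and s0: "Re s0 > \<sigma> + 1"
  shows "(deriv ^^ k) l s0 = 0"
proof (rule ccontr)
  let ?W = "{s. Re s > \<sigma>}"
  have W: "open ?W" by (rule open_halfspace_Re_gt)
  define H where "H = (deriv ^^ k) l"
  define \<delta> where "\<delta> = norm (H s0)"
  assume "(deriv ^^ k) l s0 \<noteq> 0"
  hence \<delta>: "\<delta> > 0" by (simp add: \<delta>_def H_def)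
  have near: "Re s > \<sigma> \<and> Re s \<le> Re s0 + 1" if "norm (s0 - s) \<le> 1" for s
    using abs_Re_le_cmod[of "s0 - s"] that s0 by auto
  \<comment> \<open>The tolerance absorbs the factor \<open>fact k\<close> of Cauchy's estimate and
    leaves an error of at most \<open>\<delta>/2\<close>.\<close>
  obtain S where S: "finite S" "\<And>\<tau>. \<exists>\<nu>\<in>S. \<forall>s. \<sigma> < Re s \<longrightarrow> Re s \<le> Re s0 + 1 \<longrightarrow>
          norm (l (s + \<i> * of_real (\<tau> - \<nu>)) - l s) \<le> \<delta> / (2 * fact k)"
    using ap[of "\<delta> / (2 * fact k)"] \<delta> by auto
  \<comment> \<open>Every \<open>\<tau>\<close> differs from an almost period by an element of the finite set \<open>S\<close>, so the mean of
    finitely many translates of \<open>|H|\<close> is bounded below.\<close>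
  have large: "\<delta> / 2 \<le> (\<Sum>\<nu>\<in>S. norm (H (s0 - \<i> * of_real \<nu> + \<i> * of_real \<tau>)))" for \<tau>
  proof -
    obtain \<nu> where \<nu>: "\<nu> \<in> S" "\<And>s. \<sigma> < Re s \<Longrightarrow> Re s \<le> Re s0 + 1 \<Longrightarrow>
          norm (l (s + \<i> * of_real (\<tau> - \<nu>)) - l s) \<le> \<delta> / (2 * fact k)"
      using S(2)[of \<tau>] by auto
    define b where "b = \<i> * complex_of_real (\<tau> - \<nu>)"
    have Wb: "1 * w + b \<in> ?W" if "w \<in> ?W" for w using that by (simp add: b_def)
    have lb: "(\<lambda>s. l (1 * s + b)) holomorphic_on ?W"
      by (intro holomorphic_on_compose_gen[OF _ l, unfolded o_def] holomorphic_intros) (use Wb in auto)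
    have "(deriv ^^ k) (\<lambda>s. l (1 * s + b) - l s) s0 = (deriv ^^ k) (\<lambda>s. l (1 * s + b)) s0 - (deriv ^^ k) l s0"
      using s0 by (intro higher_deriv_diff[OF lb l W]) simp
    also have "(deriv ^^ k) (\<lambda>s. l (1 * s + b)) s0 = 1 ^ k * (deriv ^^ k) l (1 * s0 + b)"
      using s0 by (intro higher_deriv_compose_linear'[OF l W W _ Wb]) auto
    finally have "H (s0 + b) - H s0 = (deriv ^^ k) (\<lambda>s. l (1 * s + b) - l s) s0" by (simp add: H_def)
    also have "norm \<dots> \<le> fact k * (\<delta> / (2 * fact k)) / 1 ^ k"
    proof (rule Cauchy_inequality)
      have hol: "(\<lambda>s. l (1 * s + b) - l s) holomorphic_on cball s0 1"
        by (rule holomorphic_on_subset[of _ ?W]) (use near lb l in \<open>auto simp: dist_norm intro: holomorphic_intros\<close>)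
      show "(\<lambda>s. l (1 * s + b) - l s) holomorphic_on ball s0 1"
        by (rule holomorphic_on_subset[OF hol]) auto
      show "continuous_on (cball s0 1) (\<lambda>s. l (1 * s + b) - l s)"
        by (rule holomorphic_on_imp_continuous_on[OF hol])
      show "norm (l (1 * s + b) - l s) \<le> \<delta> / (2 * fact k)" if "norm (s0 - s) = 1" for s
        using \<nu>(2)[of s] near[of s] that by (simp add: b_def)
    qed auto
    finally have "norm (H (s0 + b) - H s0) \<le> \<delta> / 2" by simp
    hence "\<delta> / 2 \<le> norm (H (s0 + b))"
      using norm_triangle_ineq2[of "H s0" "H (s0 + b)"] by (simp add: \<delta>_def norm_minus_commute)
    also have "s0 + b = s0 - \<i> * of_real \<nu> + \<i> * of_real \<tau>" by (simp add: b_def algebra_simps)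
    also have "norm (H (s0 - \<i> * of_real \<nu> + \<i> * of_real \<tau>)) \<le> (\<Sum>\<nu>\<in>S. norm (H (s0 - \<i> * of_real \<nu> + \<i> * of_real \<tau>)))"
      using \<nu>(1) S(1) by (intro member_le_sum) auto
    finally show ?thesis .
  qed
  \<comment> \<open>The \<open>card S\<close> translates, each of mean at most \<eta>, then sum to
    at most \<open>\<delta>/4\<close>, below the lower bound \<open>\<delta>/2\<close>. Adding 1
    keeps the divisor positive.\<close>
  define \<eta> where "\<eta> = \<delta> / (4 * (card S + 1))"
  have \<eta>: "\<eta> > 0" using \<delta> by (simp add: \<eta>_def)
  have "eventually (\<lambda>T. \<forall>\<nu>\<in>S. integral {0..T} (\<lambda>\<tau>. norm (H (s0 - \<i> * of_real \<nu> + \<i> * of_real \<tau>))) \<le> \<eta> * T) at_top"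
    unfolding H_def using S(1) by (intro eventually_ball_finite ballI mean \<eta>) auto
  hence "eventually (\<lambda>T::real. False) at_top"
    using eventually_gt_at_top[of 0]
  proof eventually_elim
    case (elim T)
    have contH: "continuous_on ?W H"
      unfolding H_def by (intro holomorphic_on_imp_continuous_on holomorphic_higher_deriv l W)
    have int: "(\<lambda>\<tau>. norm (H (s0 - \<i> * of_real \<nu> + \<i> * of_real \<tau>))) integrable_on {0..T}" for \<nu>
    proof -
      have "continuous_on {0..T} (\<lambda>\<tau>. s0 - \<i> * of_real \<nu> + \<i> * of_real \<tau>)"
        by (intro continuous_intros)
      with contH have "continuous_on {0..T} (\<lambda>\<tau>. H (s0 - \<i> * of_real \<nu> + \<i> * of_real \<tau>))"
        by (rule continuous_on_compose2) (use s0 in auto)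
      thus ?thesis by (intro integrable_continuous_interval continuous_on_norm)
    qed
    have "T * (\<delta> / 2) = integral {0..T} (\<lambda>\<tau>. \<delta> / 2)" using elim by simp
    also have "\<dots> \<le> integral {0..T} (\<lambda>\<tau>. \<Sum>\<nu>\<in>S. norm (H (s0 - \<i> * of_real \<nu> + \<i> * of_real \<tau>)))"
      by (intro integral_le large integrable_const_ivl integrable_sum S int)
    also have "\<dots> = (\<Sum>\<nu>\<in>S. integral {0..T} (\<lambda>\<tau>. norm (H (s0 - \<i> * of_real \<nu> + \<i> * of_real \<tau>))))"
      by (intro integral_sum S int)
    also have "\<dots> \<le> (\<Sum>\<nu>\<in>S. \<eta> * T)" using elim by (intro sum_mono) auto
    also have "\<dots> = card S * \<eta> * T" by simp
    also have "\<dots> \<le> \<delta> / 4 * T"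
      using elim \<delta> by (intro mult_right_mono) (auto simp: \<eta>_def field_simps)
    finally show False using elim \<delta> by simp
  qed
  thus False by simp
qed

subsection \<open>Derivatives of holomorphic functions\<close>

text \<open>A differentiated Schwarz formula. An imaginary constant added to \<open>g\<close> does
  not change \<open>Re g\<close>, so the order of the derivative must be at least 1. The constant
  comes from \<open>norm (w \<theta> - z) \<ge> R / 2\<close> on the circle.\<close>

lemma higher_deriv_le_integral_abs_Re:
  fixes g :: "complex \<Rightarrow> complex"
  assumes holo: "g holomorphic_on ball 0 R'" and R: "0 < R" "R < R'" and z: "norm z \<le> R / 2" and "k \<ge> 1"
  shows "norm ((deriv ^^ k) g z) \<le> fact k * 2 ^ (k + 1) / (pi * R ^ k) *
           integral {0..2*pi} (\<lambda>\<theta>. \<bar>Re (g (of_real R * cis \<theta>))\<bar>)"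
proof -
  define w where "w = (\<lambda>\<theta>. of_real R * cis \<theta>)"
  define D where "D = (deriv ^^ k) g z"
  have w[simp]: "norm (w \<theta>) = R" for \<theta> using R by (simp add: w_def norm_mult)
  have wz: "w \<theta> - z \<noteq> 0" for \<theta> using w[of \<theta>] z R by auto
  have contg: "continuous_on (cball 0 R) g"
    using R by (intro holomorphic_on_imp_continuous_on holomorphic_on_subset[OF holo]) auto
  have holg: "g holomorphic_on ball 0 R"
    using R by (intro holomorphic_on_subset[OF holo]) auto
  have "((\<lambda>u. g u / (u - z) ^ Suc k) has_contour_integral (2 * pi * \<i> / fact k * D)) (circlepath 0 R)"
    unfolding D_def using z R
    by (intro Cauchy_has_contour_integral_higher_derivative_circlepath contg holg) auto
  hence I1: "((\<lambda>\<theta>. g (w \<theta>) / (w \<theta> - z) ^ Suc k * (\<i> * w \<theta>)) has_integral (2 * pi * \<i> / fact k * D)) {0..2*pi}"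
    unfolding circlepath_def by (subst (asm) has_contour_integral_part_circlepath_iff) (auto simp: w_def mult_ac)
  \<comment> \<open>On the circle, \<open>cnj g / (w - z)\<^sup>k\<^sup>+\<^sup>1 dw\<close> is up to a constant the conjugate of \<open>h dw\<close> with \<open>h\<close>
    holomorphic in the disc; so its integral vanishes and \<open>g\<close> may be replaced by \<open>2 Re g\<close> in
    Cauchy's formula.\<close>
  define h where "h = (\<lambda>u. g u * u ^ (k - 1) / (of_real (R\<^sup>2) - cnj z * u) ^ Suc k)"
  \<comment> \<open>The denominator of \<open>h\<close> can vanish only at the mirror image of
    \<open>z\<close> in the circle, whose modulus is at least \<open>2 * R\<close>. So
    \<open>h\<close> is holomorphic on a disc that contains the circle of radius
    \<open>R\<close>.\<close>
  define e where "e = min R' (2 * R)"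
  have nz: "of_real (R\<^sup>2) - cnj z * u \<noteq> 0" if "norm u < 2 * R" for u
  proof
    assume "of_real (R\<^sup>2) - cnj z * u = 0"
    hence "norm (cnj z * u) = norm (of_real (R\<^sup>2) :: complex)" by simp
    moreover have "norm (cnj z * u) < R\<^sup>2"
    proof (cases "z = 0")
      case False
      hence "norm z * norm u < norm z * (2 * R)" using that by simp
      also have "\<dots> \<le> R / 2 * (2 * R)" using z R by (intro mult_right_mono) auto
      finally show ?thesis by (simp add: norm_mult power2_eq_square)
    qed (use R in auto)
    ultimately show False by (simp add: norm_power)
  qed
  have "h holomorphic_on ball 0 e"
    unfolding h_def using nz 
    by (intro holomorphic_intros holomorphic_on_subset[OF holo]) (auto simp: e_def)
  hence "(h has_contour_integral 0) (circlepath 0 R)"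
    using R by (intro Cauchy_theorem_disc_simple[of h 0 e]) (auto simp: e_def path_image_circlepath)
  hence "((\<lambda>\<theta>. h (w \<theta>) * (\<i> * w \<theta>)) has_integral 0) {0..2*pi}"
    unfolding circlepath_def by (subst (asm) has_contour_integral_part_circlepath_iff) (auto simp: w_def mult_ac)
  from iffD2[OF has_integral_cnj this]
  have "((\<lambda>\<theta>. - of_real (R\<^sup>2) * cnj (h (w \<theta>) * (\<i> * w \<theta>))) has_integral (- of_real (R\<^sup>2) * cnj 0)) {0..2*pi}"
    unfolding o_def by (rule has_integral_mult_right)
  moreover have "- of_real (R\<^sup>2) * cnj (h (w \<theta>) * (\<i> * w \<theta>)) = cnj (g (w \<theta>)) / (w \<theta> - z) ^ Suc k * (\<i> * w \<theta>)" for \<theta>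
  proof -
    define v where "v = w \<theta>"
    have v: "v * cnj v = of_real (R\<^sup>2)" "v \<noteq> 0" "v - z \<noteq> 0"
      using w[of \<theta>] R wz[of \<theta>] by (auto simp: v_def complex_norm_square[symmetric] simp del: w)
    have "cnj (of_real (R\<^sup>2) - cnj z * v) = cnj v * (v - z)" using v(1) by (simp add: algebra_simps)
    hence "cnj (h v) = cnj (g v) * cnj v ^ (k - 1) / (cnj v * (v - z)) ^ Suc k"
      unfolding h_def by simp
    also have "\<dots> = cnj (g v) / (cnj v ^ 2 * (v - z) ^ Suc k)"
    proof -
      \<comment> \<open>\<open>k \<ge> 1\<close> makes \<open>k - 1\<close> a true predecessor. The
        two powers of \<open>cnj v\<close> left over cancel against
        \<open>R\<^sup>2 = v * cnj v\<close> and the conjugated differential.\<close>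
      have "Suc k = (k - 1) + 2" using \<open>k \<ge> 1\<close> by simp
      hence "cnj v ^ Suc k = cnj v ^ (k - 1) * cnj v ^ 2" by (metis power_add)
      thus ?thesis using v unfolding power_mult_distrib by (simp del: power_Suc)
    qed
    finally have "- of_real (R\<^sup>2) * cnj (h v * (\<i> * v)) = (v * cnj v) * (cnj (g v) / (cnj v ^ 2 * (v - z) ^ Suc k)) * (\<i> * cnj v)"
      using v by simp
    also have "\<dots> = cnj (g v) / (v - z) ^ Suc k * (\<i> * v)"
    proof -
      have "(v * q) * (x / (q ^ 2 * p)) * (\<i> * q) = x / p * (\<i> * v)" if "q \<noteq> 0" "p \<noteq> 0" for x p q :: complex
        using that by (simp add: field_simps power2_eq_square)
      from this[of "cnj v" "(v - z) ^ Suc k" "cnj (g v)"] v(2,3) show ?thesis by (simp only: complex_cnj_zero_iff power_eq_0_iff not_False_eq_True simp_thms)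
    qed
    finally show ?thesis unfolding v_def .
  qed
  ultimately have "((\<lambda>\<theta>. cnj (g (w \<theta>)) / (w \<theta> - z) ^ Suc k * (\<i> * w \<theta>)) has_integral 0) {0..2*pi}"
    by simp
  from has_integral_add[OF I1 this] 
  have I: "((\<lambda>\<theta>. of_real (2 * Re (g (w \<theta>))) / (w \<theta> - z) ^ Suc k * (\<i> * w \<theta>)) has_integral (2 * pi * \<i> / fact k * D)) {0..2*pi}"
    by (simp add: ring_distribs[symmetric] add_divide_distrib[symmetric] complex_add_cnj)
  have cont: "continuous_on {0..2*pi} (\<lambda>\<theta>. \<bar>Re (g (w \<theta>))\<bar>)"
    unfolding w_def using R
    by (intro continuous_intros continuous_on_compose2[OF contg]) (auto simp: norm_mult)
  have "norm (2 * pi * \<i> / fact k * D) \<le> integral {0..2*pi} (\<lambda>\<theta>. 2 * R / (R / 2) ^ Suc k * \<bar>Re (g (w \<theta>))\<bar>)"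
    unfolding integral_unique[OF I, symmetric]
  proof (rule integral_norm_bound_integral)
    show "(\<lambda>\<theta>. 2 * R / (R / 2) ^ Suc k * \<bar>Re (g (w \<theta>))\<bar>) integrable_on {0..2*pi}"
      by (intro integrable_continuous_interval continuous_intros cont)
    fix \<theta> assume "\<theta> \<in> {0..2*pi}"
    have "R / 2 \<le> norm (w \<theta> - z)" using norm_triangle_ineq2[of "w \<theta>" z] z by simp
    hence "(R / 2) ^ Suc k \<le> norm (w \<theta> - z) ^ Suc k" using R by (intro power_mono) auto
    hence "2 * \<bar>Re (g (w \<theta>))\<bar> * R / norm (w \<theta> - z) ^ Suc k \<le> 2 * \<bar>Re (g (w \<theta>))\<bar> * R / (R / 2) ^ Suc k"
      using R by (intro divide_left_mono mult_pos_pos zero_less_power) (use wz in auto)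
    thus "norm (of_real (2 * Re (g (w \<theta>))) / (w \<theta> - z) ^ Suc k * (\<i> * w \<theta>)) \<le> 2 * R / (R / 2) ^ Suc k * \<bar>Re (g (w \<theta>))\<bar>"
      by (simp add: norm_mult norm_divide norm_power mult_ac abs_mult del: power_Suc)
  qed (use I in blast)
  also have "\<dots> = 2 * R / (R / 2) ^ Suc k * integral {0..2*pi} (\<lambda>\<theta>. \<bar>Re (g (w \<theta>))\<bar>)"
    by simp
  finally have "2 * pi / fact k * norm D \<le> 2 * R / (R / 2) ^ Suc k * integral {0..2*pi} (\<lambda>\<theta>. \<bar>Re (g (w \<theta>))\<bar>)"
    by (simp add: norm_mult norm_divide)
  hence "norm D \<le> (2 * R / (R / 2) ^ Suc k * integral {0..2*pi} (\<lambda>\<theta>. \<bar>Re (g (w \<theta>))\<bar>)) * (fact k / (2 * pi))"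
    by (simp add: field_simps)
  also have "\<dots> = fact k * 2 ^ (k + 1) / (pi * R ^ k) * integral {0..2*pi} (\<lambda>\<theta>. \<bar>Re (g (w \<theta>))\<bar>)"
    using R by (simp add: field_simps power_divide)
  finally show ?thesis unfolding D_def w_def .
qed

text \<open>The real part of Cauchy's formula at the centre, that is, the mean value property of
  \<open>Re g\<close>.\<close>

lemma integral_Re_circle:
  fixes g :: "complex \<Rightarrow> complex"
  assumes holo: "g holomorphic_on ball 0 R'" and R: "0 < R" "R < R'"
  shows "integral {0..2*pi} (\<lambda>\<theta>. Re (g (of_real R * cis \<theta>))) = 2 * pi * Re (g 0)"
proof -
  have "g holomorphic_on cball 0 R"
    using R by (intro holomorphic_on_subset[OF holo]) auto
  hence "((\<lambda>u. g u / (u - 0)) has_contour_integral (2 * pi * \<i> * g 0)) (circlepath 0 R)"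
    using Cauchy_integral_circlepath_simple[of g 0 R 0] R by simp
  hence "((\<lambda>\<theta>. \<i> * g (of_real R * cis \<theta>)) has_integral (2 * pi * \<i> * g 0)) {0..2*pi}"
    unfolding circlepath_def using R
    by (subst (asm) has_contour_integral_part_circlepath_iff) (auto simp: mult_ac)
  from has_integral_mult_right[OF this, of "-\<i>"]
  have "((\<lambda>\<theta>. g (of_real R * cis \<theta>)) has_integral (2 * pi * g 0)) {0..2*pi}"
    by (simp add: mult_ac)
  from has_integral_Re[OF this] show ?thesis by (simp add: integral_unique)
qed

text \<open>The right half-plane is open and avoids the branch cut, so the induction hypothesis
  holds near \<open>z\<close> and can be differentiated. The index starts at the first derivative,
  where the logarithm has become a power.\<close>

lemma higher_deriv_Ln:
  assumes "Re z > 0"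
  shows "(deriv ^^ Suc j) Ln z = (-1) ^ j * fact j / z ^ Suc j"
  using assms
proof (induction j arbitrary: z)
  case 0
  have "deriv Ln z = inverse z"
    using 0 by (intro DERIV_imp_deriv has_field_derivative_Ln) (auto simp: complex_nonpos_Reals_iff)
  thus ?case by (simp add: field_simps)
next
  case (Suc j)
  have z: "z \<noteq> 0" using Suc.prems by auto
  have "(deriv ^^ Suc (Suc j)) Ln z = deriv ((deriv ^^ Suc j) Ln) z" by simp
  also have "\<dots> = deriv (\<lambda>w. (-1) ^ j * fact j / w ^ Suc j) z"
  proof (rule deriv_cong_ev)
    have "eventually (\<lambda>w. w \<in> {w. Re w > 0}) (nhds z)"
      using Suc.prems by (intro eventually_nhds_in_open open_halfspace_Re_gt) auto
    thus "eventually (\<lambda>w. (deriv ^^ Suc j) Ln w = (-1) ^ j * fact j / w ^ Suc j) (nhds z)"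
      by eventually_elim (use Suc.IH in auto)
  qed simp
  also have "\<dots> = (-1) ^ Suc j * fact (Suc j) / z ^ Suc (Suc j)"
  proof (rule DERIV_imp_deriv)
    have "((\<lambda>w. (-1) ^ j * fact j * inverse (w ^ Suc j)) has_field_derivative
       ((-1) ^ j * fact j * (- (inverse (z ^ Suc j) * (of_nat (Suc j) * z ^ j) * inverse (z ^ Suc j))))) (at z)"
      by (intro DERIV_cmult DERIV_inverse')
         (use z DERIV_power[OF DERIV_ident, where n="Suc j" and x=z] in \<open>simp_all del: power_Suc\<close>)
    moreover have "((-1) ^ j * fact j * (- (inverse (z ^ Suc j) * (of_nat (Suc j) * z ^ j) * inverse (z ^ Suc j))))
      = (-1) ^ Suc j * fact (Suc j) / z ^ Suc (Suc j)"
      using z by (simp add: field_simps)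
    ultimately show "((\<lambda>w. (-1) ^ j * fact j / w ^ Suc j) has_field_derivative
       (-1) ^ Suc j * fact (Suc j) / z ^ Suc (Suc j)) (at z)"
      by (simp add: field_simps)
  qed
  finally show ?case .
qed

lemma norm_higher_deriv_Ln:
  assumes "Re z > 0" "k \<ge> 1"
  shows "norm ((deriv ^^ k) Ln z) \<le> fact k / norm z ^ k"
proof -
  obtain j where k: "k = Suc j" using assms by (cases k) auto
  have "norm ((deriv ^^ k) Ln z) = fact j / norm z ^ k"
    unfolding k higher_deriv_Ln[OF assms(1)] by (simp add: norm_mult norm_divide norm_power)
  also have "\<dots> \<le> fact k / norm z ^ k"
    unfolding k by (intro divide_right_mono fact_mono) auto
  finally show ?thesis .
qed

lemma higher_deriv_sum:
  assumes "\<And>i. i \<in> I \<Longrightarrow> f i holomorphic_on S" "open S" "z \<in> S"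
  shows "(deriv ^^ n) (\<lambda>w. \<Sum>i\<in>I. f i w) z = (\<Sum>i\<in>I. (deriv ^^ n) (f i) z)"
  using assms(1)
proof (induction I rule: infinite_finite_induct)
  case (insert i I)
  have "(deriv ^^ n) (\<lambda>w. f i w + (\<Sum>i\<in>I. f i w)) z = (deriv ^^ n) (f i) z + (deriv ^^ n) (\<lambda>w. \<Sum>i\<in>I. f i w) z"
    using insert.prems assms(2,3) by (intro higher_deriv_add[of _ S] holomorphic_intros) auto
  thus ?case using insert by simp
qed auto

text \<open>The order is lowered one at a time. If one derivative vanishes, the preceding one is
  constant, and Cauchy's estimate on unit discs far to the right makes this constant 0 because
  \<open>l\<close> tends to 0 there.\<close>

lemma holomorphic_zero_if_higher_deriv_zero:
  fixes l :: "complex \<Rightarrow> complex"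
  assumes l: "l holomorphic_on {s. Re s > \<sigma>}" and lim: "(l \<longlongrightarrow> 0) (filtercomap Re at_top)"
    and zero: "\<And>s. Re s > \<sigma> \<Longrightarrow> (deriv ^^ k) l s = 0" and s: "Re s > \<sigma>"
  shows "l s = 0"
  using zero s
proof (induction k arbitrary: s)
  case (Suc k)
  have W: "open {s. Re s > \<sigma>}" "connected {s. Re s > \<sigma>}"
    by (auto intro!: convex_connected convex_halfspace_Re_gt open_halfspace_Re_gt)
  have "(deriv ^^ k) l constant_on {s. Re s > \<sigma>}"
  proof (rule has_field_derivative_0_imp_constant_on[OF _ W(2,1)])
    fix z assume "z \<in> {s. Re s > \<sigma>}"
    thus "((deriv ^^ k) l has_field_derivative 0) (at z)"
      using has_field_derivative_higher_deriv[OF l W(1), of z k] Suc.prems(1)[of z] by simp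
  qed
  then obtain d where d: "\<And>z. Re z > \<sigma> \<Longrightarrow> (deriv ^^ k) l z = d"
    by (auto simp: constant_on_def)
  have "norm d \<le> e" if "e > 0" for e
  proof -
    have "eventually (\<lambda>s. dist (l s) 0 < e / fact k) (filtercomap Re at_top)"
      using tendstoD[OF lim, of "e / fact k"] that by simp
    then obtain X where X: "\<And>s. Re s \<ge> X \<Longrightarrow> norm (l s) < e / fact k"
      by (auto simp: eventually_filtercomap eventually_at_top_linorder)
    \<comment> \<open>So far to the right that the closed unit disc about \<open>x\<close> lies both
      in the half-plane and where \<open>l\<close> is small.\<close>
    define x where "x = complex_of_real (max X \<sigma> + 2)"
    have x: "Re u > \<sigma> \<and> Re u \<ge> X" if "norm (x - u) \<le> 1" for u
      using complex_Re_le_cmod[of "x - u"] that by (auto simp: x_def)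
    have "norm ((deriv ^^ k) l x) \<le> fact k * (e / fact k) / 1 ^ k"
    proof (rule Cauchy_inequality)
      show "l holomorphic_on ball x 1"
        by (rule holomorphic_on_subset[OF l]) (use x in \<open>auto simp: dist_norm less_imp_le\<close>)
      show "continuous_on (cball x 1) l"
        by (intro holomorphic_on_imp_continuous_on holomorphic_on_subset[OF l]) (use x in \<open>auto simp: dist_norm\<close>)
    qed (use X x in \<open>auto intro: less_imp_le\<close>)
    thus ?thesis using d[of x] x[of x] by simp
  qed
  hence "norm d \<le> 0" by (rule field_le_epsilon) simp
  hence "\<And>z. Re z > \<sigma> \<Longrightarrow> (deriv ^^ k) l z = 0" using d by simp
  thus ?case using Suc.IH Suc.prems(2) by blast
qed auto

subsection \<open>Blaschke factorization\<close>

text \<open>The factor for the disc of radius \<open>R\<close>, normalised to modulus 1 on the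
  boundary circle. For a nonzero \<rho> in the open disc its pole is the mirror image of \<rho> in
  that circle.\<close>

definition blaschke :: "real \<Rightarrow> complex \<Rightarrow> complex \<Rightarrow> complex" where
  "blaschke R \<rho> z = of_real R * (z - \<rho>) / (of_real (R\<^sup>2) - cnj \<rho> * z)"

text \<open>The second hypothesis keeps the mirror image of \<rho> outside the disc of radius
  \<open>R'\<close>. Positivity of the real part, rather than mere nonvanishing, later makes
  \<open>Ln\<close> of the denominator holomorphic.\<close>

lemma blaschke_denom_pos:
  assumes "norm z < R'" "norm \<rho> * R' < R\<^sup>2"
  shows "Re (of_real (R\<^sup>2) - cnj \<rho> * z) > 0"
proof -
  have "Re (cnj \<rho> * z) \<le> norm \<rho> * norm z" using complex_Re_le_cmod[of "cnj \<rho> * z"] by (simp add: norm_mult)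
  also have "\<dots> \<le> norm \<rho> * R'" using assms by (intro mult_left_mono) auto
  finally show ?thesis using assms by simp
qed

lemma blaschke_denom_nonzero:
  assumes "norm z < R'" "norm \<rho> * R' < R\<^sup>2"
  shows "of_real (R\<^sup>2) - cnj \<rho> * z \<noteq> 0"
  using blaschke_denom_pos[OF assms] by (metis less_irrefl zero_complex.simps(1))

lemma blaschke_analytic:
  assumes "norm z < R'" "norm \<rho> * R' < R\<^sup>2"
  shows "blaschke R \<rho> analytic_on {z}"
  unfolding blaschke_def using blaschke_denom_nonzero[OF assms]
  by (auto intro!: analytic_intros)

text \<open>On the circle \<open>z * cnj z = R\<^sup>2\<close>, so the conjugate of the denominator
  factors as \<open>cnj z * (z - \<rho>)\<close>.\<close>

lemma norm_blaschke_circle: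
  assumes "norm z = R" "norm \<rho> < R"
  shows "norm (blaschke R \<rho> z) = 1"
proof -
  have R: "R > 0" using assms by (metis norm_ge_zero order_le_less_trans)
  have zz: "z * cnj z = of_real (R\<^sup>2)" using assms complex_norm_square by metis
  have "cnj (of_real (R\<^sup>2) - cnj \<rho> * z) = cnj z * (z - \<rho>)" using zz by (simp add: algebra_simps)
  hence "norm (of_real (R\<^sup>2) - cnj \<rho> * z) = norm (cnj z * (z - \<rho>))" by (metis complex_mod_cnj)
  hence "norm (of_real (R\<^sup>2) - cnj \<rho> * z) = R * norm (z - \<rho>)" using assms by (simp add: norm_mult)
  moreover have "z \<noteq> \<rho>" using assms by auto
  ultimately show ?thesis using R by (simp add: blaschke_def norm_divide norm_mult)
qed

lemma zorder_blaschke: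
  assumes "norm z < R'" "norm \<rho> * R' < R\<^sup>2" "R > 0"
  shows "zorder (blaschke R \<rho>) z = (if z = \<rho> then 1 else 0)"
proof -
  define A where "A = ball (0::complex) R'"
  have den: "of_real (R\<^sup>2) - cnj \<rho> * u \<noteq> 0" if "u \<in> A" for u
    using blaschke_denom_nonzero[of u R' \<rho> R] that assms by (auto simp: A_def)
  have holo: "(\<lambda>u. of_real R / (of_real (R\<^sup>2) - cnj \<rho> * u)) holomorphic_on A"
    using den by (intro holomorphic_intros) auto
  show ?thesis
  proof (cases "z = \<rho>")
    case True
    thus ?thesis using assms den
      by (auto simp: A_def blaschke_def intro!: zorder_eqI[OF _ _ holo])
  next
    case False
    have "blaschke R \<rho> holomorphic_on A" unfolding blaschke_def[abs_def] using den by (intro holomorphic_intros) auto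
    moreover have "blaschke R \<rho> z \<noteq> 0" using False den[of z] assms by (auto simp: A_def blaschke_def)
    ultimately show ?thesis using False assms
      by (auto simp: A_def intro!: zorder_eqI[of A z "blaschke R \<rho>"])
  qed
qed

lemma eventually_nonzero_nicely_meromorphic:
  assumes "F nicely_meromorphic_on UNIV" "\<not> (\<exists>k. \<forall>s. F s = k)"
  shows "eventually (\<lambda>w. F w \<noteq> c) (at z)"
  using frequently_eq_meromorphic_imp_constant[OF _ assms(1), of c z] assms(2)
  by (auto simp: frequently_def)

text \<open>An accumulation point in the compact disc would contradict the identity theorem. The set
  contains the poles as well, since \<open>F\<close> has the value 0 there.\<close>

lemma finite_zeros_nicely_meromorphic:
  assumes "F nicely_meromorphic_on UNIV" "\<not> (\<exists>k. \<forall>s. F s = k)"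
  shows "finite {z. F z = 0 \<and> norm z \<le> r}"
proof (rule ccontr)
  assume "infinite {z. F z = 0 \<and> norm z \<le> r}"
  moreover have "{z. F z = 0 \<and> norm z \<le> r} \<subseteq> cball 0 r" by auto
  ultimately obtain x where "x islimpt {z. F z = 0 \<and> norm z \<le> r}"
    using Heine_Borel_imp_Bolzano_Weierstrass[OF compact_cball] by blast
  moreover have "eventually (\<lambda>w. w \<notin> {z. F z = 0 \<and> norm z \<le> r}) (at x)"
    using eventually_nonzero_nicely_meromorphic[OF assms, of 0 x] by eventually_elim simp
  ultimately show False by (simp add: islimpt_iff_eventually)
qed

text \<open>The Blaschke product carries the order of \<open>F\<close> at each of its zeros and
  poles in the disc; poles belong to \<open>Z\<close> too and enter with negative exponents. The
  quotient has order 0 throughout, so with its singularities removed it is holomorphic and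
  zero-free, and on a disc it has a logarithm \<open>g\<close>.\<close>

lemma meromorphic_blaschke_factorization:
  assumes F: "F nicely_meromorphic_on UNIV" "\<not> (\<exists>k. \<forall>s. F s = k)"
    and R: "0 < R" "R < R'"
    and Z: "Z = {z. F z = 0 \<and> norm z < R'}" "\<And>\<rho>. \<rho> \<in> Z \<Longrightarrow> norm \<rho> * R' < R\<^sup>2"
  obtains g where "g holomorphic_on ball 0 R'"
    "\<And>z. z \<in> ball 0 R' - Z \<Longrightarrow> F z = exp (g z) * (\<Prod>\<rho>\<in>Z. blaschke R \<rho> z powi (zorder F \<rho>))"
proof -
  have finZ: "finite Z"
    by (rule finite_subset[OF _ finite_zeros_nicely_meromorphic[OF F, of R']]) (auto simp: Z(1))
  define B where "B = (\<lambda>z. \<Prod>\<rho>\<in>Z. blaschke R \<rho> z powi (zorder F \<rho>))"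
  \<comment> \<open>At points of \<open>Z\<close> the value of \<open>G0\<close> is 0 because
    \<open>F\<close> is 0 there; \<open>remove_sings\<close> replaces it by the limit.\<close>
  define G0 where "G0 = (\<lambda>z. F z / B z)"
  define G where "G = remove_sings G0"
  have mF: "F meromorphic_on A" for A
    using F(1) by (auto simp: nicely_meromorphic_on_def intro: meromorphic_on_subset)
  have bmero: "blaschke R \<rho> meromorphic_on {z}" if "z \<in> ball 0 R'" "\<rho> \<in> Z" for z \<rho>
    using that Z(2) by (intro analytic_on_imp_meromorphic_on blaschke_analytic[of _ R']) auto
  have bnz: "blaschke R \<rho> z \<noteq> 0" if "z \<in> ball 0 R'" "\<rho> \<in> Z" "z \<noteq> \<rho>" for z \<rho>
    using blaschke_denom_nonzero[of z R' \<rho> R] that Z(2) R by (auto simp: blaschke_def)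
  have Bmero: "B meromorphic_on {z}" if "z \<in> ball 0 R'" for z
    unfolding B_def using that by (intro meromorphic_intros bmero) auto
  have Bnz: "B z \<noteq> 0" if "z \<in> ball 0 R' - Z" for z
    unfolding B_def using finZ bnz that by (auto simp: power_int_eq_0_iff)
  have evZ: "eventually (\<lambda>w. w \<in> ball 0 R' - Z) (at z)" if "z \<in> ball 0 R'" for z
    using eventually_at_in_open'[of "ball 0 R'" z] islimpt_finite[OF finZ, of z] that
    unfolding islimpt_iff_eventually by (auto elim: eventually_elim2)
  have G0mero: "G0 meromorphic_on ball 0 R'"
    unfolding G0_def
    by (subst meromorphic_on_meromorphic_at) (intro ballI meromorphic_intros mF Bmero)
  hence Gn: "G nicely_meromorphic_on ball 0 R'"
    unfolding G_def by (rule remove_sings_nicely_meromorphic)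
  have G_eq: "G analytic_on {z} \<and> G z \<noteq> 0" if z: "z \<in> ball 0 R'" for z
  proof -
    have evF: "eventually (\<lambda>w. F w \<noteq> 0) (at z)" by (rule eventually_nonzero_nicely_meromorphic[OF F])
    have evB: "eventually (\<lambda>w. B w \<noteq> 0) (at z)" using evZ[OF z] by (rule eventually_mono) (rule Bnz)
    have zB: "zorder B z = (if z \<in> Z then zorder F z else 0)"
    proof -
      have "zorder B z = (\<Sum>\<rho>\<in>Z. zorder (\<lambda>w. blaschke R \<rho> w powi (zorder F \<rho>)) z)"
        unfolding B_def using z evB
        by (intro zorder_prod meromorphic_intros bmero) (auto simp: B_def)
      also have "\<dots> = (\<Sum>\<rho>\<in>Z. if \<rho> = z then zorder F z else 0)"
      proof (intro sum.cong refl)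
        fix \<rho> assume \<rho>: "\<rho> \<in> Z"
        have "eventually (\<lambda>w. blaschke R \<rho> w \<noteq> 0) (at z)"
          using evZ[OF z] by (rule eventually_mono) (use bnz \<rho> in auto)
        hence "zorder (\<lambda>w. blaschke R \<rho> w powi (zorder F \<rho>)) z = zorder F \<rho> * zorder (blaschke R \<rho>) z"
          using bmero[OF z \<rho>] by (intro zorder_power_int eventually_frequently) auto
        thus "zorder (\<lambda>w. blaschke R \<rho> w powi (zorder F \<rho>)) z = (if \<rho> = z then zorder F z else 0)"
          using zorder_blaschke[of z R' \<rho> R] Z(2)[OF \<rho>] R z by auto
      qed
      finally show ?thesis using finZ by simp
    qed
    have zF: "zorder F z = 0" if "z \<notin> Z"
    proof -
      have "F z \<noteq> 0" using that z by (auto simp: Z(1))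
      moreover from this have "\<not> is_pole F z" using is_pole_zero_at_nicely_mero[OF F(1)] by auto
      hence "F analytic_on {z}" using nicely_meromorphic_on_imp_analytic_at[OF F(1)] by auto
      ultimately show ?thesis
        by (auto simp: analytic_at intro!: zorder_eqI[of _ z F])
    qed
    have "zorder G z = zorder G0 z"
      unfolding G_def using G0mero z
      by (intro zorder_remove_sings) (auto simp: meromorphic_on_altdef)
    also have "\<dots> = zorder F z - zorder B z"
      unfolding G0_def using evF evB z by (intro zorder_divide mF Bmero eventually_frequently) auto
    also have "\<dots> = 0" using zB zF by auto
    finally have z0: "zorder G z = 0" .
    have Gm: "G meromorphic_on {z}" "isolated_singularity_at G z"
      using Gn z by (auto simp: nicely_meromorphic_on_def meromorphic_on_altdef)
    \<comment> \<open>Order 0 excludes both a pole and an isolated zero. As \<open>G\<close> does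
      not vanish identically near \<open>z\<close>, this leaves only
      \<open>G z \<noteq> 0\<close>.\<close>
    have np: "\<not> is_pole G z" using isolated_pole_imp_neg_zorder[OF Gm(2)] z0 by auto
    have nz: "\<not> isolated_zero G z" using zorder_isolated_zero_pos'[OF _ Gm(2)] z0 by auto
    have "eventually (\<lambda>w. G0 w \<noteq> 0) (at z)"
      using evF evB by eventually_elim (auto simp: G0_def)
    moreover have "eventually (\<lambda>w. G w = G0 w) (at z)"
      unfolding G_def using G0mero z by (intro eventually_remove_sings_eq_at) (auto simp: meromorphic_on_altdef)
    ultimately have "eventually (\<lambda>w. G w \<noteq> 0) (at z)" by eventually_elim auto
    hence "G z \<noteq> 0" using zero_or_pole[OF Gn z] np nz by blast
    thus ?thesis using nicely_meromorphic_on_imp_analytic_at[OF Gn z np] by blast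
  qed
  hence "G holomorphic_on ball 0 R'"
    by (meson analytic_imp_holomorphic analytic_on_analytic_at)
  moreover have "\<And>z. z \<in> ball 0 R' \<Longrightarrow> G z \<noteq> 0" using G_eq by blast
  ultimately obtain g where g: "g holomorphic_on ball 0 R'" "\<And>z. z \<in> ball 0 R' \<Longrightarrow> exp (g z) = G z"
    using holomorphic_logarithm_exists[of "ball 0 R'" G 0] R by auto
  show ?thesis
  proof
    show "g holomorphic_on ball 0 R'" by fact
    fix z assume z: "z \<in> ball 0 R' - Z"
    have "F z \<noteq> 0" using z by (auto simp: Z(1))
    hence "\<not> is_pole F z" using is_pole_zero_at_nicely_mero[OF F(1)] by auto
    hence "F analytic_on {z}" using nicely_meromorphic_on_imp_analytic_at[OF F(1)] by auto
    moreover have "B analytic_on {z}" unfolding B_def using z bnz Z(2)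
      by (intro analytic_intros blaschke_analytic[of z R']) auto
    ultimately have "G0 analytic_on {z}" unfolding G0_def using Bnz[OF z]
      by (intro analytic_intros) auto
    hence "G z = F z / B z" unfolding G_def by (simp add: G0_def)
    hence "F z = exp (g z) * B z" using g(2)[of z] z Bnz[OF z] by (simp add: field_simps)
    thus "F z = exp (g z) * (\<Prod>\<rho>\<in>Z. blaschke R \<rho> z powi (zorder F \<rho>))" by (simp add: B_def)
  qed
qed

text \<open>To the right of all points of \<open>Z\<close>, both \<open>s - \<rho>\<close> and the
  Blaschke denominators have positive real part, so principal logarithms add up to a branch of the
  logarithm of the product. Differentiating \<open>k\<close> times, each \<rho> contributes a term
  in \<open>1 / norm (s - \<rho>) ^ k\<close> and its denominator a term in
  \<open>(2 / R) ^ k\<close>.\<close>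

lemma norm_higher_deriv_log_le:
  fixes F l g :: "complex \<Rightarrow> complex" and m :: "complex \<Rightarrow> int"
  assumes g: "g holomorphic_on ball 0 R'" and R: "0 < R" "R < R'" and "finite Z"
    and Z: "\<And>\<rho>. \<rho> \<in> Z \<Longrightarrow> norm \<rho> * R' < R\<^sup>2" "\<And>\<rho>. \<rho> \<in> Z \<Longrightarrow> Re \<rho> \<le> \<sigma>"
    and l: "l holomorphic_on {s. Re s > \<sigma>}" and "c \<noteq> 0"
    and eq: "\<And>s. Re s > \<sigma> \<Longrightarrow> norm s < R' \<Longrightarrow> 
       c * exp (l s) = exp (g s) * (\<Prod>\<rho>\<in>Z. blaschke R \<rho> s powi (m \<rho>))"
    and k: "k \<ge> 1" and s: "Re s > \<sigma>" "norm s \<le> R / 2"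
  shows "norm ((deriv ^^ k) l s) \<le> norm ((deriv ^^ k) g s) +
      (\<Sum>\<rho>\<in>Z. fact k * real_of_int \<bar>m \<rho>\<bar> * (1 / norm (s - \<rho>) ^ k + (2 / R) ^ k))"
proof -
  define V where "V = {s. Re s > \<sigma>} \<inter> ball 0 R'"
  have V: "open V" "connected V"
    unfolding V_def by (auto intro!: convex_connected convex_Int convex_halfspace_Re_gt open_halfspace_Re_gt)
  have sV: "s \<in> V" using s R by (simp add: V_def)
  \<comment> \<open>Written as affine maps to fit the chain rule
    \<open>higher_deriv_compose_linear'\<close>.\<close>
  define L1 where "L1 = (\<lambda>\<rho> s. Ln (1 * s + (- \<rho>)))"
  define L2 where "L2 = (\<lambda>\<rho> s. Ln (- cnj \<rho> * s + of_real (R\<^sup>2)))"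
  define L where "L = (\<lambda>\<rho> s. of_int (m \<rho>) * (Ln (of_real R) + (L1 \<rho> s - L2 \<rho> s)))"
  define \<Lambda> where "\<Lambda> = (\<lambda>s. g s + (\<Sum>\<rho>\<in>Z. L \<rho> s))"
  have re1: "Re (1 * s + (-\<rho>)) > 0" if "\<rho> \<in> Z" "s \<in> V" for s \<rho>
    using Z(2)[OF that(1)] that(2) by (simp add: V_def)
  have re2: "Re (- cnj \<rho> * s + of_real (R\<^sup>2)) > 0" if "\<rho> \<in> Z" "s \<in> V" for s \<rho>
    using blaschke_denom_pos[of s R' \<rho> R] Z(1)[OF that(1)] that(2) by (simp add: V_def)
  have holLn: "Ln holomorphic_on {s. Re s > 0}"
    by (intro holomorphic_intros) (auto simp: complex_nonpos_Reals_iff)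
  have hol1: "L1 \<rho> holomorphic_on V" if "\<rho> \<in> Z" for \<rho>
    unfolding L1_def using re1[OF that]
    by (intro holomorphic_on_compose_gen[OF _ holLn, unfolded o_def] holomorphic_intros) auto
  have hol2: "L2 \<rho> holomorphic_on V" if "\<rho> \<in> Z" for \<rho>
    unfolding L2_def using re2[OF that]
    by (intro holomorphic_on_compose_gen[OF _ holLn, unfolded o_def] holomorphic_intros) auto
  have holL: "L \<rho> holomorphic_on V" if "\<rho> \<in> Z" for \<rho>
    unfolding L_def using hol1[OF that] hol2[OF that] by (intro holomorphic_intros)
  have holg: "g holomorphic_on V" by (rule holomorphic_on_subset[OF g]) (auto simp: V_def)
  have hol\<Lambda>: "\<Lambda> holomorphic_on V" unfolding \<Lambda>_def by (intro holomorphic_intros holg holL)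
  have holl: "l holomorphic_on V" by (rule holomorphic_on_subset[OF l]) (auto simp: V_def)
  have exp\<Lambda>: "exp (\<Lambda> u) = c * exp (l u)" if u: "u \<in> V" for u
  proof -
    have "exp (L \<rho> u) = blaschke R \<rho> u powi (m \<rho>)" if \<rho>: "\<rho> \<in> Z" for \<rho>
    proof -
      have nz: "1 * u + (-\<rho>) \<noteq> 0" "- cnj \<rho> * u + of_real (R\<^sup>2) \<noteq> 0" 
        using re1[OF \<rho> u] re2[OF \<rho> u] by (metis less_irrefl zero_complex.simps(1))+
      have "exp (L \<rho> u) = exp (Ln (of_real R) + (L1 \<rho> u - L2 \<rho> u)) powi (m \<rho>)"
        unfolding L_def by (metis exp_power_int mult.commute)
      also have "exp (Ln (of_real R) + (L1 \<rho> u - L2 \<rho> u)) = blaschke R \<rho> u"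
        using nz R unfolding exp_add exp_diff L1_def L2_def by (simp add: blaschke_def)
      finally show ?thesis .
    qed
    thus ?thesis using eq[of u] u \<open>finite Z\<close> by (simp add: \<Lambda>_def exp_add exp_sum V_def)
  qed
  \<comment> \<open>The branches \<Lambda> and \<open>l\<close> may differ by a constant. Comparing
    the derivatives of their exponentials avoids having to determine it.\<close>
  have deq: "deriv \<Lambda> u = deriv l u" if u: "u \<in> V" for u
  proof -
    have d1: "((\<lambda>u. exp (\<Lambda> u)) has_field_derivative exp (\<Lambda> u) * deriv \<Lambda> u) (at u)"
      using holomorphic_derivI[OF hol\<Lambda> V(1) u] by (auto intro!: derivative_eq_intros)
    have d2: "((\<lambda>u. c * exp (l u)) has_field_derivative c * exp (l u) * deriv l u) (at u)"
      using holomorphic_derivI[OF holl V(1) u] by (auto intro!: derivative_eq_intros)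
    have "((\<lambda>u. exp (\<Lambda> u)) has_field_derivative c * exp (l u) * deriv l u) (at u)"
      by (rule has_field_derivative_transform_within_open[OF d2 V(1) u]) (simp add: exp\<Lambda>)
    from DERIV_unique[OF d1 this] show ?thesis using exp\<Lambda>[OF u] \<open>c \<noteq> 0\<close> by simp
  qed
  have "(deriv ^^ k) l s = (deriv ^^ (k - 1)) (deriv l) s"
    using k by (metis Suc_diff_1 funpow_Suc_right less_eq_Suc_le o_apply One_nat_def)
  also have "\<dots> = (deriv ^^ (k - 1)) (deriv \<Lambda>) s"
    by (rule higher_deriv_transform_within_open[of _ V]) (auto intro!: holomorphic_deriv holl hol\<Lambda> V sV simp: deq)
  also have "\<dots> = (deriv ^^ k) \<Lambda> s"
    using k by (metis Suc_diff_1 funpow_Suc_right less_eq_Suc_le o_apply One_nat_def)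
  also have "\<dots> = (deriv ^^ k) g s + (\<Sum>\<rho>\<in>Z. (deriv ^^ k) (L \<rho>) s)"
  proof -
    have "(deriv ^^ k) \<Lambda> s = (deriv ^^ k) g s + (deriv ^^ k) (\<lambda>s. \<Sum>\<rho>\<in>Z. L \<rho> s) s"
      unfolding \<Lambda>_def by (rule higher_deriv_add[OF holg _ V(1) sV]) (intro holomorphic_intros holL)
    thus ?thesis using higher_deriv_sum[of Z L V s k] holL V sV by simp
  qed
  finally have "norm ((deriv ^^ k) l s) \<le> norm ((deriv ^^ k) g s) + norm (\<Sum>\<rho>\<in>Z. (deriv ^^ k) (L \<rho>) s)"
    by (simp add: norm_triangle_ineq)
  also have "norm (\<Sum>\<rho>\<in>Z. (deriv ^^ k) (L \<rho>) s) \<le> 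
      (\<Sum>\<rho>\<in>Z. fact k * real_of_int \<bar>m \<rho>\<bar> * (1 / norm (s - \<rho>) ^ k + (2 / R) ^ k))"
  proof (rule sum_norm_le)
    fix \<rho> assume \<rho>: "\<rho> \<in> Z"
    have "(deriv ^^ k) (L \<rho>) s = of_int (m \<rho>) * (deriv ^^ k) (\<lambda>s. Ln (of_real R) + (L1 \<rho> s - L2 \<rho> s)) s"
      unfolding L_def by (rule higher_deriv_cmult[of _ V]) (intro holomorphic_intros hol1 hol2 V sV \<rho>)+
    also have "(deriv ^^ k) (\<lambda>s. Ln (of_real R) + (L1 \<rho> s - L2 \<rho> s)) s 
        = (deriv ^^ k) (\<lambda>s. Ln (of_real R)) s + (deriv ^^ k) (\<lambda>s. L1 \<rho> s - L2 \<rho> s) s"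
      by (rule higher_deriv_add[of _ V]) (intro holomorphic_intros hol1 hol2 V sV \<rho>)+
    also have "(deriv ^^ k) (\<lambda>s. L1 \<rho> s - L2 \<rho> s) s = (deriv ^^ k) (L1 \<rho>) s - (deriv ^^ k) (L2 \<rho>) s"
      by (rule higher_deriv_diff[of _ V]) (intro hol1 hol2 V sV \<rho>)+
    also have "(deriv ^^ k) (L1 \<rho>) s = 1 ^ k * (deriv ^^ k) Ln (1 * s + (- \<rho>))"
      unfolding L1_def using re1[OF \<rho>]
      by (intro higher_deriv_compose_linear'[OF holLn V(1) open_halfspace_Re_gt sV]) auto
    also have "(deriv ^^ k) (L2 \<rho>) s = (- cnj \<rho>) ^ k * (deriv ^^ k) Ln (- cnj \<rho> * s + of_real (R\<^sup>2))"
      unfolding L2_def using re2[OF \<rho>]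
      by (intro higher_deriv_compose_linear'[OF holLn V(1) open_halfspace_Re_gt sV]) auto
    finally have "norm ((deriv ^^ k) (L \<rho>) s) = real_of_int \<bar>m \<rho>\<bar> * norm 
        ((deriv ^^ k) Ln (s - \<rho>) - (- cnj \<rho>) ^ k * (deriv ^^ k) Ln (- cnj \<rho> * s + of_real (R\<^sup>2)))"
      using k by (simp add: norm_mult)
    also have "\<dots> \<le> real_of_int \<bar>m \<rho>\<bar> * (fact k / norm (s - \<rho>) ^ k + fact k * (2 / R) ^ k)"
    proof (intro mult_left_mono order_trans[OF norm_triangle_ineq4] add_mono)
      show "norm ((deriv ^^ k) Ln (s - \<rho>)) \<le> fact k / norm (s - \<rho>) ^ k"
        using norm_higher_deriv_Ln[of "s - \<rho>" k] re1[OF \<rho> sV] k by simp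
      have \<rho>R: "norm \<rho> \<le> R"
      proof -
        have "norm \<rho> * R \<le> norm \<rho> * R'" using R by (intro mult_left_mono) auto
        hence "norm \<rho> * R < R * R" using Z(1)[OF \<rho>] by (simp add: power2_eq_square)
        thus ?thesis using R by (simp add: mult_less_cancel_right)
      qed
      have "R\<^sup>2 / 2 \<le> R\<^sup>2 - norm (cnj \<rho> * s)"
      proof -
        have "norm \<rho> * norm s \<le> R * (R / 2)" using \<rho>R s R by (intro mult_mono) auto
        thus ?thesis by (simp add: norm_mult power2_eq_square field_simps)
      qed
      also have "\<dots> \<le> norm (- cnj \<rho> * s + of_real (R\<^sup>2))"
        using norm_triangle_ineq2[of "of_real (R\<^sup>2)" "cnj \<rho> * s"] by (simp add: norm_power add.commute)
      finally have den: "R\<^sup>2 / 2 \<le> norm (- cnj \<rho> * s + of_real (R\<^sup>2))" .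
      have "norm ((- cnj \<rho>) ^ k * (deriv ^^ k) Ln (- cnj \<rho> * s + of_real (R\<^sup>2))) 
          \<le> norm \<rho> ^ k * (fact k / norm (- cnj \<rho> * s + of_real (R\<^sup>2)) ^ k)"
        unfolding norm_mult norm_power norm_minus_cancel complex_mod_cnj
        by (intro mult_left_mono norm_higher_deriv_Ln[OF re2[OF \<rho> sV] k]) auto
      also have "\<dots> \<le> R ^ k * (fact k / (R\<^sup>2 / 2) ^ k)"
        using \<rho>R den R by (intro mult_mono power_mono divide_left_mono mult_pos_pos zero_less_power) auto
      also have "\<dots> = fact k * (2 / R) ^ k"
        using R by (simp add: field_simps power2_eq_square power_mult_distrib power_divide)
      finally show "norm ((- cnj \<rho>) ^ k * (deriv ^^ k) Ln (- cnj \<rho> * s + of_real (R\<^sup>2))) \<le> fact k * (2 / R) ^ k" .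
    qed auto
    finally show "norm ((deriv ^^ k) (L \<rho>) s) \<le> fact k * real_of_int \<bar>m \<rho>\<bar> * (1 / norm (s - \<rho>) ^ k + (2 / R) ^ k)"
      by (simp add: algebra_simps)
  qed
  finally show ?thesis by simp
qed

subsection \<open>Counting functions and proximity function\<close>

text \<open>A point at distance \<open>p\<close> from the origin is counted from
  \<open>t = p\<close> on; this integral is its contribution to the integrated counting
  function.\<close>

lemma has_integral_truncated_inverse:
  fixes p R :: real
  assumes "0 < p" "p \<le> R"
  shows "((\<lambda>t. if p \<le> t then 1 / t else 0) has_integral (ln R - ln p)) {0..R}"
proof -
  have "((\<lambda>t. 1 / t) has_integral (ln R - ln p)) {p..R}"
    using assms by (intro fundamental_theorem_of_calculus)
      (auto intro!: derivative_eq_intros simp: has_real_derivative_iff_has_vector_derivative[symmetric])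
  hence "((\<lambda>t. if t \<in> {p..R} then 1 / t else 0) has_integral (ln R - ln p)) {0..R}"
    using assms by (subst has_integral_restrict) auto
  thus ?thesis by (rule has_integral_eq[rotated]) auto
qed

text \<open>Sum and integral are interchanged, point by point. A point at the origin cancels in
  \<open>n t - n 0\<close> and enters only through \<open>n 0 * ln R\<close>.\<close>

lemma integrated_counting_eq:
  fixes Z :: "complex set" and m :: "complex \<Rightarrow> real"
  assumes fin: "\<And>r. finite {z\<in>Z. norm z \<le> r}" and "R > 0"
  defines "n \<equiv> (\<lambda>r. \<Sum>z\<in>{z\<in>Z. norm z \<le> r}. m z)"
  shows "integrated_counting n R = (\<Sum>z\<in>{z\<in>Z. norm z \<le> R} - {0}. m z * (ln R - ln (norm z))) + n 0 * ln R"
proof -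
  let ?A = "{z\<in>Z. norm z \<le> R} - {0}"
  have "((\<lambda>t. \<Sum>z\<in>?A. m z * (if norm z \<le> t then 1 / t else 0)) has_integral
           (\<Sum>z\<in>?A. m z * (ln R - ln (norm z)))) {0..R}"
    by (intro has_integral_sum has_integral_mult_right has_integral_truncated_inverse) (use fin in auto)
  moreover have "(\<Sum>z\<in>?A. m z * (if norm z \<le> t then 1 / t else 0)) = (n t - n 0) / t" if t: "t \<in> {0..R}" for t
  proof -
    have "n t - n 0 = (\<Sum>z\<in>{z\<in>Z. norm z \<le> t} - {z\<in>Z. norm z \<le> 0}. m z)"
      unfolding n_def using fin t by (subst sum_diff) auto
    also have "{z\<in>Z. norm z \<le> t} - {z\<in>Z. norm z \<le> 0} = {z\<in>?A. norm z \<le> t}"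
      using t by auto
    finally have "n t - n 0 = (\<Sum>z\<in>{z\<in>?A. norm z \<le> t}. m z)" .
    also have "\<dots> = (\<Sum>z\<in>?A. if norm z \<le> t then m z else 0)"
      using fin by (subst sum.inter_filter[symmetric]) auto
    also have "\<dots> / t = (\<Sum>z\<in>?A. m z * (if norm z \<le> t then 1 / t else 0))"
      unfolding sum_divide_distrib by (intro sum.cong) auto
    finally show ?thesis ..
  qed
  ultimately have "((\<lambda>t. (n t - n 0) / t) has_integral (\<Sum>z\<in>?A. m z * (ln R - ln (norm z)))) {0..R}"
    by (rule has_integral_eq[rotated])
  thus ?thesis unfolding integrated_counting_def by (simp add: integral_unique)
qed

text \<open>Enlarging the radius by the factor \<open>exp 1\<close> makes
  \<open>ln (exp 1 * r) - ln (norm z)\<close> at least 1 for each nonzero point of modulus at most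
  \<open>r\<close>. With \<open>r \<ge> 1\<close> the factor \<open>ln (exp 1 * r)\<close> at the
  origin is at least 1 too.\<close>

lemma integrated_counting_ge:
  fixes Z :: "complex set" and m :: "complex \<Rightarrow> real"
  assumes fin: "\<And>r. finite {z\<in>Z. norm z \<le> r}" and "r \<ge> 1" and m: "\<And>z. z \<in> Z \<Longrightarrow> m z \<ge> 0"
  defines "n \<equiv> (\<lambda>r. \<Sum>z\<in>{z\<in>Z. norm z \<le> r}. m z)"
  shows "integrated_counting n (exp 1 * r) \<ge> n r" "integrated_counting n r \<ge> 0"
proof -
  have n0: "n 0 \<ge> 0" unfolding n_def using m by (auto intro: sum_nonneg)
  let ?A = "\<lambda>r. {z\<in>Z. norm z \<le> r} - {0}"
  have *: "r \<le> exp 1 * r" using \<open>r \<ge> 1\<close> by (simp add: exp_ge_one_plus_x_over_n_power_n)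
  have le: "m z * ln (norm z) \<le> m z * (ln r)" if "z \<in> ?A r" for z
    using that m \<open>r \<ge> 1\<close> by (intro mult_left_mono) auto
  have "(\<Sum>z\<in>?A r. m z) \<le> (\<Sum>z\<in>?A r. m z * (ln (exp 1 * r) - ln (norm z)))"
    using \<open>r \<ge> 1\<close> le by (intro sum_mono) (auto simp: ln_mult algebra_simps)
  also have "\<dots> \<le> (\<Sum>z\<in>?A (exp 1 * r). m z * (ln (exp 1 * r) - ln (norm z)))"
    using fin m * \<open>r \<ge> 1\<close>
    by (intro sum_mono2) (auto intro!: mult_nonneg_nonneg simp: ln_le_cancel_iff[symmetric] simp del: ln_le_cancel_iff)
  finally have 1: "(\<Sum>z\<in>?A r. m z) \<le> (\<Sum>z\<in>?A (exp 1 * r). m z * (ln (exp 1 * r) - ln (norm z)))" .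
  have "n r = (\<Sum>z\<in>?A r. m z) + n 0"
  proof -
    have "n r = (\<Sum>z\<in>?A r \<union> {z\<in>Z. norm z \<le> 0}. m z)"
      unfolding n_def using \<open>r \<ge> 1\<close> by (intro sum.cong) auto
    also have "\<dots> = (\<Sum>z\<in>?A r. m z) + n 0" unfolding n_def using fin[of r] fin[of 0]
      by (subst sum.union_disjoint) auto
    finally show ?thesis .
  qed
  moreover have "n 0 \<le> n 0 * ln (exp 1 * r)" using n0 \<open>r \<ge> 1\<close> 
    by (simp add: ln_mult mult_le_cancel_left1 distrib_left)
  ultimately show "integrated_counting n (exp 1 * r) \<ge> n r"
    using 1 integrated_counting_eq[OF fin, of "exp 1 * r" m] \<open>r \<ge> 1\<close> unfolding n_def by simp
  have "0 \<le> (\<Sum>z\<in>?A r. m z * (ln r - ln (norm z)))"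
    using le by (intro sum_nonneg) (auto simp: algebra_simps)
  thus "integrated_counting n r \<ge> 0"
    using integrated_counting_eq[OF fin, of r m] \<open>r \<ge> 1\<close> n0 unfolding n_def by simp
qed

text \<open>Since \<open>F\<close> takes the value \<open>0\<close> at its poles, this sum counts the poles as well as the zeros.\<close>

definition divisor_count :: "(complex \<Rightarrow> complex) \<Rightarrow> real \<Rightarrow> real" where
  "divisor_count F r = (\<Sum>z\<in>{z. F z = 0 \<and> norm z \<le> r}. real_of_int \<bar>zorder F z\<bar>)"

text \<open>The zero set of the representative splits into true zeros, of positive order, and poles,
  of negative order. Hence the sum of the absolute orders is the sum of the two counting functions,
  and each of these is bounded by its integrated form at radius \<open>exp 1 * r\<close>.\<close>

lemma
  assumes F: "F nicely_meromorphic_on UNIV" "\<not> (\<exists>k. \<forall>s. F s = k)" and r: "r \<ge> 1"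
  shows divisor_count_le_N: "divisor_count F r \<le> N_a F 0 (exp 1 * r) + N_poles F (exp 1 * r)"
    and N_poles_nonneg: "N_poles F r \<ge> 0"
proof -
  define A where "A = {z. \<not> is_pole F z \<and> F z = 0}"
  define B where "B = {z. is_pole F z}"
  have BF: "F z = 0" if "z \<in> B" for z
    using is_pole_zero_at_nicely_mero[OF F(1)] that by (auto simp: B_def)
  have iso: "isolated_singularity_at F z" for z
    using F(1) by (auto simp: nicely_meromorphic_on_def meromorphic_on_altdef)
  have finA: "finite {z\<in>A. norm z \<le> t}" for t
    by (rule finite_subset[OF _ finite_zeros_nicely_meromorphic[OF F, of t]]) (auto simp: A_def)
  have finB: "finite {z\<in>B. norm z \<le> t}" for t
    by (rule finite_subset[OF _ finite_zeros_nicely_meromorphic[OF F, of t]]) (use BF in auto)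
  have posA: "zorder F z > 0" if "z \<in> A" for z
  proof (rule zorder_isolated_zero_pos'[OF _ iso])
    show "isolated_zero F z"
      using zero_or_pole[OF F(1), of z] eventually_nonzero_nicely_meromorphic[OF F, of 0 z] that
      by (auto simp: A_def)
  qed
  have negB: "zorder F z < 0" if "z \<in> B" for z
    using isolated_pole_imp_neg_zorder[OF iso] that by (auto simp: B_def)
  have ca: "count_a F 0 = (\<lambda>r. \<Sum>z\<in>{z\<in>A. norm z \<le> r}. real_of_int (zorder F z))"
    unfolding count_a_def A_def by (intro ext sum.cong) auto
  have cp: "count_poles F = (\<lambda>r. \<Sum>z\<in>{z\<in>B. norm z \<le> r}. real_of_int (- zorder F z))"
    unfolding count_poles_def B_def by (intro ext sum.cong) auto
  have "divisor_count F r = count_a F 0 r + count_poles F r"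
  proof -
    have "divisor_count F r = (\<Sum>z\<in>{z\<in>A. norm z \<le> r} \<union> {z\<in>B. norm z \<le> r}. real_of_int \<bar>zorder F z\<bar>)"
      unfolding divisor_count_def by (rule sum.cong) (use BF in \<open>auto simp: A_def B_def\<close>)
    also have "\<dots> = (\<Sum>z\<in>{z\<in>A. norm z \<le> r}. real_of_int \<bar>zorder F z\<bar>) + (\<Sum>z\<in>{z\<in>B. norm z \<le> r}. real_of_int \<bar>zorder F z\<bar>)"
      by (rule sum.union_disjoint[OF finA finB]) (auto simp: A_def B_def)
    also have "(\<Sum>z\<in>{z\<in>A. norm z \<le> r}. real_of_int \<bar>zorder F z\<bar>) = count_a F 0 r"
      unfolding ca by (rule sum.cong) (use posA in force)+
    also have "(\<Sum>z\<in>{z\<in>B. norm z \<le> r}. real_of_int \<bar>zorder F z\<bar>) = count_poles F r"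
      unfolding cp by (rule sum.cong) (use negB in force)+
    finally show ?thesis .
  qed
  moreover have "count_a F 0 r \<le> N_a F 0 (exp 1 * r)"
    unfolding N_a_def ca using posA by (intro integrated_counting_ge(1)[OF finA r]) (auto simp: less_imp_le)
  moreover have "count_poles F r \<le> N_poles F (exp 1 * r)"
    unfolding N_poles_def cp using negB by (intro integrated_counting_ge(1)[OF finB r]) (force simp: less_imp_le)
  ultimately show "divisor_count F r \<le> N_a F 0 (exp 1 * r) + N_poles F (exp 1 * r)" by simp
  show "N_poles F r \<ge> 0"
    unfolding N_poles_def cp using negB by (intro integrated_counting_ge(2)[OF finB r]) (force simp: less_imp_le)
qed

text \<open>Jensen's formula at the origin: the leading Laurent coefficient \<open>P 0\<close> of
  \<open>F\<close> is compared with that of the factorization. The constant depends on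
  \<open>F\<close> alone because nonzero zeros and poles keep a fixed distance from the
  origin.\<close>

lemma abs_Re_blaschke_quotient_at_0:
  assumes F: "F nicely_meromorphic_on UNIV" "\<not> (\<exists>k. \<forall>s. F s = k)"
  obtains C where "C \<ge> 0"
    "\<And>R R' Z g. \<lbrakk>1 \<le> R; R < R'; Z = {z. F z = 0 \<and> norm z < R'}; \<And>\<rho>. \<rho> \<in> Z \<Longrightarrow> norm \<rho> * R' < R\<^sup>2;
       g holomorphic_on ball 0 R';
       \<And>z. z \<in> ball 0 R' - Z \<Longrightarrow> F z = exp (g z) * (\<Prod>\<rho>\<in>Z. blaschke R \<rho> z powi (zorder F \<rho>))\<rbrakk>
       \<Longrightarrow> \<bar>Re (g 0)\<bar> \<le> C + (\<Sum>\<rho>\<in>Z. real_of_int \<bar>zorder F \<rho>\<bar>) * (ln R + C)"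
proof -
  have mF: "isolated_singularity_at F 0" "not_essential F 0"
    using F(1) by (auto simp: nicely_meromorphic_on_def meromorphic_on_altdef)
  have evF: "eventually (\<lambda>w. F w \<noteq> 0) (at z)" for z by (rule eventually_nonzero_nicely_meromorphic[OF F])
  define P where "P = zor_poly F 0"
  define m0 where "m0 = zorder F 0"
  obtain r where r: "P 0 \<noteq> 0" "r > 0" "P holomorphic_on cball 0 r"
    "\<And>w. w \<in> cball 0 r - {0} \<Longrightarrow> F w = P w * w powi m0 \<and> P w \<noteq> 0"
    using zorder_exist[OF mF eventually_frequently[OF _ evF]] unfolding P_def m0_def by auto
  have m0: "m0 = 0" if "F 0 \<noteq> 0"
  proof -
    have "\<not> is_pole F 0" using is_pole_zero_at_nicely_mero[OF F(1)] that by auto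
    hence "F analytic_on {0}" using nicely_meromorphic_on_imp_analytic_at[OF F(1)] by auto
    thus ?thesis using that unfolding m0_def
      by (auto simp: analytic_at intro!: zorder_eqI[of _ 0 F])
  qed
  define r0 where "r0 = min r 1"
  have r0: "0 < r0" "r0 \<le> 1" "r0 \<le> r" using r by (auto simp: r0_def)
  have nz: "F w \<noteq> 0" if "norm w \<le> r0" "w \<noteq> 0" for w
    using r(4)[of w] that r0 by (auto simp: power_int_eq_0_iff)
  \<comment> \<open>The second entry bounds \<open>- ln (norm \<rho>)\<close> for every nonzero zero
    or pole \<rho>.\<close>
  define C where "C = max \<bar>ln (norm (P 0))\<bar> (- ln r0)"
  show ?thesis
  proof
    show "C \<ge> 0" by (simp add: C_def)
    fix R R' :: real and Z :: "complex set" and g :: "complex \<Rightarrow> complex"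
    assume R: "1 \<le> R" "R < R'" and Z: "Z = {z. F z = 0 \<and> norm z < R'}" "\<And>\<rho>. \<rho> \<in> Z \<Longrightarrow> norm \<rho> * R' < R\<^sup>2"
      and g: "g holomorphic_on ball 0 R'"
        "\<And>z. z \<in> ball 0 R' - Z \<Longrightarrow> F z = exp (g z) * (\<Prod>\<rho>\<in>Z. blaschke R \<rho> z powi (zorder F \<rho>))"
    have finZ: "finite Z"
      by (rule finite_subset[OF _ finite_zeros_nicely_meromorphic[OF F, of R']]) (auto simp: Z(1))
    \<comment> \<open>The factorization without its factor at the origin. It is continuous at 0, so
      its identity with \<open>P\<close>, valid on a punctured disc, extends to 0 by taking
      limits.\<close>
    define Q where "Q = (\<lambda>w. exp (g w) * (\<Prod>\<rho>\<in>Z-{0}. blaschke R \<rho> w powi (zorder F \<rho>)))"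
    have "eventually (\<lambda>w. Q w = P w * of_real R powi m0) (at 0)"
    proof -
      have "eventually (\<lambda>w. w \<in> ball 0 r0 - {0}) (at 0)"
        using r0 by (intro eventually_at_in_open) auto
      thus ?thesis
      proof eventually_elim
        case (elim w)
        have w: "w \<noteq> 0" "norm w \<le> r0" "w \<in> ball 0 R' - Z" 
          using elim nz[of w] R r0 by (auto simp: Z(1))
        have "F w = Q w * (w / of_real R) powi m0"
        proof (cases "0 \<in> Z")
          case True
          have "blaschke R 0 w = w / of_real R" using R by (simp add: blaschke_def power2_eq_square)
          thus ?thesis using g(2)[OF w(3)] finZ True unfolding Q_def m0_def
            by (simp add: prod.remove[of Z 0] mult_ac)
        next
          case False
          hence "F 0 \<noteq> 0" using R by (auto simp: Z(1))
          thus ?thesis using g(2)[OF w(3)] False m0 by (simp add: Q_def)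
        qed
        moreover have "F w = P w * w powi m0" using r(4)[of w] w r0 by auto
        ultimately have "P w * w powi m0 = Q w * (w powi m0 / of_real R powi m0)"
          by (simp add: power_int_divide_distrib)
        thus ?case using w R by (simp add: field_simps power_int_eq_0_iff)
      qed
    qed
    moreover have "isCont Q 0"
    proof -
      have "continuous_on (ball 0 R') g" using g(1) by (rule holomorphic_on_imp_continuous_on)
      hence "isCont g 0" using R by (intro continuous_on_interior[of "ball 0 R'"]) auto
      moreover have "isCont (\<lambda>w. blaschke R \<rho> w powi (zorder F \<rho>)) 0" if "\<rho> \<in> Z - {0}" for \<rho>
      proof -
        have "(\<lambda>w. blaschke R \<rho> w powi (zorder F \<rho>)) analytic_on {0}"
          using that Z(2) R by (intro analytic_intros blaschke_analytic[of 0 R']) (auto simp: blaschke_def)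
        thus ?thesis by (rule analytic_at_imp_isCont)
      qed
      ultimately show ?thesis unfolding Q_def by (intro isCont_mult isCont_exp' continuous_prod) auto
    qed
    moreover have "isCont (\<lambda>w. P w * of_real R powi m0) 0"
    proof -
      have "continuous_on (cball 0 r) P" using r(3) by (rule holomorphic_on_imp_continuous_on)
      hence "isCont P 0" using r(2) by (intro continuous_on_interior[of "cball 0 r"]) auto
      thus ?thesis by (intro continuous_intros)
    qed
    ultimately have "Q 0 = P 0 * of_real R powi m0"
      unfolding isCont_def using tendsto_cong[of Q "\<lambda>w. P w * of_real R powi m0" "at 0"] LIM_unique by blast
    hence "norm (Q 0) = norm (P 0) * R powi m0"
      using R by (simp add: norm_mult norm_power_int)
    moreover have "norm (Q 0) = exp (Re (g 0)) * (\<Prod>\<rho>\<in>Z-{0}. (norm \<rho> / R) powi (zorder F \<rho>))"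
      using R by (simp add: Q_def norm_mult prod_norm[symmetric] norm_power_int norm_divide blaschke_def power2_eq_square)
    ultimately have "exp (Re (g 0)) * (\<Prod>\<rho>\<in>Z-{0}. (norm \<rho> / R) powi (zorder F \<rho>)) = norm (P 0) * R powi m0"
      by simp
    moreover have "(\<Prod>\<rho>\<in>Z-{0}. (norm \<rho> / R) powi (zorder F \<rho>)) = exp (\<Sum>\<rho>\<in>Z-{0}. real_of_int (zorder F \<rho>) * (ln (norm \<rho>) - ln R))"
      unfolding exp_sum[OF finite_Diff[OF finZ]] using R
      by (intro prod.cong refl) (auto simp: exp_power_int[symmetric] exp_diff)
    moreover have "norm (P 0) * R powi m0 = exp (ln (norm (P 0)) + real_of_int m0 * ln R)"
      using R r(1) by (simp add: exp_add exp_power_int[symmetric])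
    ultimately have "Re (g 0) + (\<Sum>\<rho>\<in>Z-{0}. real_of_int (zorder F \<rho>) * (ln (norm \<rho>) - ln R)) = ln (norm (P 0)) + real_of_int m0 * ln R"
      by (simp add: exp_add[symmetric])
    hence "\<bar>Re (g 0)\<bar> \<le> \<bar>ln (norm (P 0))\<bar> + \<bar>real_of_int m0 * ln R\<bar> + \<bar>\<Sum>\<rho>\<in>Z-{0}. real_of_int (zorder F \<rho>) * (ln (norm \<rho>) - ln R)\<bar>"
      by linarith
    also have "\<bar>ln (norm (P 0))\<bar> \<le> C" by (simp add: C_def)
    also have "\<bar>\<Sum>\<rho>\<in>Z-{0}. real_of_int (zorder F \<rho>) * (ln (norm \<rho>) - ln R)\<bar> \<le> (\<Sum>\<rho>\<in>Z-{0}. real_of_int \<bar>zorder F \<rho>\<bar> * (ln R + C))"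
    proof (intro order_trans[OF sum_abs] sum_mono)
      fix \<rho> assume \<rho>: "\<rho> \<in> Z - {0}"
      have "r0 < norm \<rho>" using nz[of \<rho>] \<rho> by (auto simp: Z(1) not_le[symmetric])
      hence 1: "ln r0 \<le> ln (norm \<rho>)" using r0 by (subst ln_le_cancel_iff) auto
      have "norm \<rho> \<le> R"
      proof -
        have "norm \<rho> * R \<le> norm \<rho> * R'" using R by (intro mult_left_mono) auto
        also have "\<dots> < R * R" using Z(2)[of \<rho>] \<rho> by (simp add: power2_eq_square)
        finally have "norm \<rho> * R < R * R" .
        thus ?thesis using R by (simp add: mult_less_cancel_right)
      qed
      hence 2: "ln (norm \<rho>) \<le> ln R" using \<rho> R by (subst ln_le_cancel_iff) auto
      have "\<bar>ln (norm \<rho>) - ln R\<bar> \<le> ln R + C" using 1 2 by (simp add: C_def)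
      thus "\<bar>real_of_int (zorder F \<rho>) * (ln (norm \<rho>) - ln R)\<bar> \<le> real_of_int \<bar>zorder F \<rho>\<bar> * (ln R + C)"
        by (simp add: abs_mult mult_left_mono)
    qed
    also have "\<bar>real_of_int m0 * ln R\<bar> \<le> (\<Sum>\<rho>\<in>Z\<inter>{0}. real_of_int \<bar>zorder F \<rho>\<bar> * (ln R + C))"
    proof (cases "0 \<in> Z")
      case True
      hence "Z \<inter> {0} = {0}" by auto
      thus ?thesis using R \<open>C \<ge> 0\<close> by (simp add: m0_def abs_mult mult_left_mono)
    next
      case False
      hence "F 0 \<noteq> 0" using R by (auto simp: Z(1))
      thus ?thesis using m0 False by simp
    qed
    also have "C + (\<Sum>\<rho>\<in>Z\<inter>{0}. real_of_int \<bar>zorder F \<rho>\<bar> * (ln R + C)) + (\<Sum>\<rho>\<in>Z-{0}. real_of_int \<bar>zorder F \<rho>\<bar> * (ln R + C))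
        = C + (\<Sum>\<rho>\<in>Z. real_of_int \<bar>zorder F \<rho>\<bar> * (ln R + C))"
      using sum.Int_Diff[OF finZ, of "\<lambda>\<rho>. real_of_int \<bar>zorder F \<rho>\<bar> * (ln R + C)" "{0}"] by simp
    finally show "\<bar>Re (g 0)\<bar> \<le> C + (\<Sum>\<rho>\<in>Z. real_of_int \<bar>zorder F \<rho>\<bar>) * (ln R + C)"
      by (simp add: sum_distrib_right)
  qed
qed

text \<open>On the circle the Blaschke factors have modulus 1, so \<open>Re g\<close> is the
  logarithm of \<open>norm (F z)\<close>. Writing the absolute value of \<open>u\<close> as
  \<open>2 * max 0 u - u\<close> leaves the proximity function and a mean value.\<close>

lemma proximity_eq_log_modulus:
  assumes g: "g holomorphic_on ball 0 R'" and R: "0 < R" "R < R'"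
    and "finite Z" "\<And>\<rho>. \<rho> \<in> Z \<Longrightarrow> norm \<rho> < R"
    and F: "\<And>z. z \<in> ball 0 R' - Z \<Longrightarrow> F z = exp (g z) * (\<Prod>\<rho>\<in>Z. blaschke R \<rho> z powi (m \<rho>))"
  shows "integral {0..2*pi} (\<lambda>\<theta>. \<bar>Re (g (of_real R * cis \<theta>))\<bar>) = 4 * pi * proximity F R - 2 * pi * Re (g 0)"
proof -
  define u where "u = (\<lambda>\<theta>. Re (g (of_real R * cis \<theta>)))"
  have "continuous_on (ball 0 R') g" using g by (rule holomorphic_on_imp_continuous_on)
  hence cont: "continuous_on {0..2*pi} u"
    unfolding u_def using R
    by (intro continuous_on_Re continuous_on_compose2[OF \<open>continuous_on (ball 0 R') g\<close>] continuous_on_mult continuous_on_const)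
       (auto simp: norm_mult intro!: continuous_intros)
  have lnF: "ln (norm (F (of_real R * cis \<theta>))) = u \<theta>" for \<theta>
  proof -
    let ?z = "of_real R * cis \<theta>"
    have z: "norm ?z = R" using R by (simp add: norm_mult)
    have "?z \<in> ball 0 R' - Z" using z R assms(5)[of ?z] by auto
    from F[OF this] have "norm (F ?z) = exp (Re (g ?z)) * (\<Prod>\<rho>\<in>Z. norm (blaschke R \<rho> ?z) powi (m \<rho>))"
      by (simp add: norm_mult prod_norm[symmetric] norm_power_int)
    also have "(\<Prod>\<rho>\<in>Z. norm (blaschke R \<rho> ?z) powi (m \<rho>)) = 1"
      using norm_blaschke_circle[OF z] assms(5) by (intro prod.neutral) auto
    finally show ?thesis by (simp add: u_def)
  qed
  have "integral {0..2*pi} (\<lambda>\<theta>. \<bar>u \<theta>\<bar>) = integral {0..2*pi} (\<lambda>\<theta>. 2 * max 0 (u \<theta>) - u \<theta>)"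
    by (intro integral_cong) auto
  also have "\<dots> = 2 * integral {0..2*pi} (\<lambda>\<theta>. max 0 (u \<theta>)) - integral {0..2*pi} u"
    using cont by (subst integral_diff) (auto intro!: integrable_continuous_interval continuous_intros)
  also have "integral {0..2*pi} (\<lambda>\<theta>. max 0 (u \<theta>)) = 2 * pi * proximity F R"
    unfolding proximity_def lnF by simp
  also have "integral {0..2*pi} u = 2 * pi * Re (g 0)"
    unfolding u_def by (rule integral_Re_circle[OF g R])
  finally show ?thesis by (simp add: u_def)
qed

text \<open>Any natural number \<open>K\<close> above some real exceeding the order bounds the
  characteristic by \<open>r ^ K\<close> eventually, and the proximity function is at most the
  characteristic since \<open>N_poles\<close> is nonnegative.\<close>

lemma eventually_proximity_le_power:
  assumes F: "F nicely_meromorphic_on UNIV" "\<not> (\<exists>k. \<forall>s. F s = k)"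
    and "nevanlinna_order F < \<infinity>"
  obtains K :: nat where "eventually (\<lambda>r. proximity F r \<le> r ^ K) at_top"
proof -
  obtain x where x: "nevanlinna_order F < ereal x"
    using assms(3) less_PInf_Ex_of_nat ereal_dense2 by blast
  define K where "K = nat \<lceil>x\<rceil>"
  have xK: "x \<le> real K" unfolding K_def by linarith
  have "eventually (\<lambda>r. ereal (max 0 (ln (nevanlinna_T F r)) / ln r) < ereal x) at_top"
    using x unfolding nevanlinna_order_def by (rule Limsup_lessD)
  hence "eventually (\<lambda>r. proximity F r \<le> r ^ K) at_top"
    using eventually_gt_at_top[of "exp 1"]
  proof eventually_elim
    case (elim r)
    have r: "r \<ge> 1" "ln r > 1" 
      using elim(2) exp_ge_add_one_self[of 1] ln_less_cancel_iff[of "exp 1" r] by (auto simp del: ln_less_cancel_iff)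
    have "nevanlinna_T F r \<le> r ^ K"
    proof (cases "nevanlinna_T F r > 0")
      case True
      have "ln (nevanlinna_T F r) / ln r \<le> max 0 (ln (nevanlinna_T F r)) / ln r"
        using r by (intro divide_right_mono) auto
      hence "ln (nevanlinna_T F r) / ln r \<le> real K" using elim(1) xK by simp
      hence "ln (nevanlinna_T F r) \<le> real K * ln r" using r by (subst (asm) pos_divide_le_eq) linarith+
      also have "\<dots> = ln (r ^ K)" using r by (simp add: ln_realpow)
      finally show ?thesis using True r by (subst (asm) ln_le_cancel_iff) auto
    next
      case False
      have "0 \<le> r ^ K" using r by simp
      thus ?thesis using False by linarith
    qed
    thus ?case using N_poles_nonneg[OF F r(1)] unfolding nevanlinna_T_def by linarith
  qed
  thus ?thesis by (rule that)
qed

text \<open>The hypothesis is used at radius \<open>exp 1 * r\<close> with tolerance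
  \<open>\<epsilon> / exp 1\<close>, to match the enlarged radius in
  \<open>divisor_count_le_N\<close>.\<close>

lemma eventually_divisor_count_le:
  assumes F: "F nicely_meromorphic_on UNIV" "\<not> (\<exists>k. \<forall>s. F s = k)"
    and "Limsup at_top (\<lambda>r. ereal ((N_a F 0 r + N_poles F r) / r)) \<le> 0" and "\<epsilon> > 0"
  shows "eventually (\<lambda>r. divisor_count F r \<le> \<epsilon> * r) at_top"
proof -
  have "Limsup at_top (\<lambda>r. ereal ((N_a F 0 r + N_poles F r) / r)) < ereal (\<epsilon> / exp 1)"
    using assms(3,4) by (simp add: le_less_trans)
  hence "eventually (\<lambda>r. ereal ((N_a F 0 r + N_poles F r) / r) < ereal (\<epsilon> / exp 1)) at_top"
    by (rule Limsup_lessD)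
  moreover have "filterlim (\<lambda>r::real. exp 1 * r) at_top at_top"
    by (rule filterlim_tendsto_pos_mult_at_top[OF tendsto_const]) (auto intro: filterlim_ident)
  ultimately have "eventually (\<lambda>r. ereal ((N_a F 0 (exp 1 * r) + N_poles F (exp 1 * r)) / (exp 1 * r)) < ereal (\<epsilon> / exp 1)) at_top"
    by (auto simp: filterlim_iff)
  thus ?thesis using eventually_ge_at_top[of 1]
  proof eventually_elim
    case (elim r)
    hence "N_a F 0 (exp 1 * r) + N_poles F (exp 1 * r) < \<epsilon> / exp 1 * (exp 1 * r)"
      by (simp only: less_ereal.simps pos_divide_less_eq mult_pos_pos exp_gt_zero)
    hence "N_a F 0 (exp 1 * r) + N_poles F (exp 1 * r) < \<epsilon> * r" by simp
    thus ?case using divisor_count_le_N[OF F elim(2)] by linarith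
  qed
qed

subsection \<open>Vertical means\<close>

lemma has_integral_inverse_one_plus_square:
  fixes T y :: real
  assumes "T \<ge> 0"
  shows "((\<lambda>t. 1 / (1 + (t + y)\<^sup>2)) has_integral (arctan (T + y) - arctan y)) {0..T}"
proof -
  have "((\<lambda>t. 1 / (1 + (t + y)\<^sup>2)) has_integral (arctan (T + y) - arctan (0 + y))) {0..T}"
    using assms
    by (intro fundamental_theorem_of_calculus)
       (auto intro!: derivative_eq_intros simp: has_real_derivative_iff_has_vector_derivative[symmetric] inverse_eq_divide)
  thus ?thesis by simp
qed

text \<open>Only finitely many moduli of zeros and poles occur up to \<open>t + 2\<close>, so some
  \<open>R\<close> in the unit interval avoids them with a gap \<open>e\<close>. Taking
  \<open>R' = R + e\<close>, each relevant modulus is at most \<open>R - e\<close>, and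
  \<open>(R - e) * (R + e) < R\<^sup>2\<close>.\<close>

lemma zero_free_circle:
  assumes F: "F nicely_meromorphic_on UNIV" "\<not> (\<exists>k. \<forall>s. F s = k)" and "t \<ge> 1"
  obtains R R' where "t \<le> R" "R \<le> t + 1" "R < R'"
    "\<And>z. F z = 0 \<Longrightarrow> norm z < R' \<Longrightarrow> norm z < R \<and> norm z * R' < R\<^sup>2"
proof -
  define A where "A = norm ` {z. F z = 0 \<and> norm z \<le> t + 2}"
  have finA: "finite A" unfolding A_def using finite_zeros_nicely_meromorphic[OF F] by blast
  moreover have "infinite {t..t+1}" by (simp add: infinite_Icc)
  ultimately obtain R where R: "R \<in> {t..t+1}" "R \<notin> A" by (meson finite_subset subsetI)
  obtain d where d: "d > 0" "\<And>x. x \<in> A \<Longrightarrow> x \<noteq> R \<Longrightarrow> d \<le> dist R x"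
    using finite_set_avoid[OF finA, of R] by blast
  \<comment> \<open>\<open>e \<le> 1\<close> keeps \<open>R + e\<close> below \<open>t + 2\<close>,
    the range covered by \<open>A\<close>.\<close>
  define e where "e = min d 1"
  have e: "0 < e" "e \<le> 1" "e \<le> d" using d by (auto simp: e_def)
  show ?thesis
  proof
    show "t \<le> R" "R \<le> t + 1" "R < R + e" using R e by auto
    fix z assume z: "F z = 0" "norm z < R + e"
    hence "norm z \<in> A" using R e by (auto simp: A_def)
    hence "e \<le> \<bar>R - norm z\<bar>" using d(2)[of "norm z"] R e by (force simp: dist_norm)
    hence le: "norm z \<le> R - e" using z by auto
    have "norm z * (R + e) \<le> (R - e) * (R + e)"
      using le e R \<open>t \<ge> 1\<close> by (intro mult_right_mono) auto
    also have "\<dots> = R\<^sup>2 - e\<^sup>2" by (simp add: power2_eq_square algebra_simps)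
    finally show "norm z < R \<and> norm z * (R + e) < R\<^sup>2"
      using le e by (auto simp: order_le_less_trans)
  qed
qed

text \<open>With \<open>R\<close> close to \<open>4 * T\<close>, the factorization on the disc of
  radius \<open>R\<close> bounds the derivative on the segment by \<open>U\<close>. After
  integration, \<open>g\<close> contributes a bounded amount, the mirror points a multiple of
  \<open>\<epsilon> * T\<close>, and each zero or pole at most a constant times its multiplicity.
  The multiplicities add up to at most \<open>\<epsilon> * R\<close>.\<close>

lemma higher_deriv_log_mean_zero:
  fixes F l :: "complex \<Rightarrow> complex"
  assumes F: "F nicely_meromorphic_on UNIV" "\<not> (\<exists>k. \<forall>s. F s = k)"
    and growth: "eventually (\<lambda>r. proximity F r \<le> r ^ K) at_top"
    and sparse: "\<And>\<epsilon>. \<epsilon> > 0 \<Longrightarrow> eventually (\<lambda>r. divisor_count F r \<le> \<epsilon> * r) at_top"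
    and l: "l holomorphic_on {s. Re s > \<sigma>}" and "c \<noteq> 0"
    and eq: "\<And>s. Re s > \<sigma> \<Longrightarrow> c * exp (l s) = F s"
    and s1: "Re s1 \<ge> \<sigma> + 1" and "\<eta> > 0"
  shows "eventually (\<lambda>T. integral {0..T} (\<lambda>\<tau>. norm ((deriv ^^ (K + 3)) l (s1 + \<i> * of_real \<tau>))) \<le> \<eta> * T) at_top"
proof -
  \<comment> \<open>The circle integral of the absolute value of \<open>Re g\<close> is of order
    \<open>R ^ (K + 2)\<close>; dividing by \<open>R ^ k\<close> in the Schwarz estimate leaves
    \<open>1 / R\<close>.\<close>
  define k where "k = K + 3"
  obtain C where C: "C \<ge> 0"
    "\<And>R R' Z g. \<lbrakk>1 \<le> R; R < R'; Z = {z. F z = 0 \<and> norm z < R'}; \<And>\<rho>. \<rho> \<in> Z \<Longrightarrow> norm \<rho> * R' < R\<^sup>2;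
       g holomorphic_on ball 0 R';
       \<And>z. z \<in> ball 0 R' - Z \<Longrightarrow> F z = exp (g z) * (\<Prod>\<rho>\<in>Z. blaschke R \<rho> z powi (zorder F \<rho>))\<rbrakk>
       \<Longrightarrow> \<bar>Re (g 0)\<bar> \<le> C + (\<Sum>\<rho>\<in>Z. real_of_int \<bar>zorder F \<rho>\<bar>) * (ln R + C)"
    by (fact abs_Re_blaschke_quotient_at_0[OF F])
  define C2 where "C2 = fact k * 2 ^ (k + 1) * (4 + 2 * (2 * C + 1))"
  \<comment> \<open>Collects the factors of \<open>\<epsilon> * T\<close>: the first summand comes
    from the mirror points, the second from the zeros and poles, with 5 from
    \<open>R \<le> 5 * T\<close>.\<close>
  define D where "D = fact k * 2 ^ k + 5 * fact k * pi"
  have C2: "C2 \<ge> 0" using C(1) by (simp add: C2_def)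
  have D: "D > 0" by (simp add: D_def add_pos_pos)
  define \<epsilon> where "\<epsilon> = min 1 (\<eta> / (2 * D))"
  have \<epsilon>: "0 < \<epsilon>" "\<epsilon> \<le> 1" "\<epsilon> * D \<le> \<eta> / 2"
  proof -
    have "\<epsilon> * D \<le> \<eta> / (2 * D) * D" using D by (intro mult_right_mono) (auto simp: \<epsilon>_def)
    thus "\<epsilon> * D \<le> \<eta> / 2" using D by simp
  qed (use D \<open>\<eta> > 0\<close> in \<open>auto simp: \<epsilon>_def\<close>)
  obtain r1 where r1: "\<And>r. r \<ge> r1 \<Longrightarrow> proximity F r \<le> r ^ K" "\<And>r. r \<ge> r1 \<Longrightarrow> divisor_count F r \<le> \<epsilon> * r"
    using eventually_conj[OF growth sparse[OF \<epsilon>(1)]] by (auto simp: eventually_at_top_linorder)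
  have main: "integral {0..T} (\<lambda>\<tau>. norm ((deriv ^^ k) l (s1 + \<i> * of_real \<tau>))) \<le> \<eta> * T"
    if T: "T \<ge> 1" "T \<ge> r1" "T \<ge> norm s1" "T \<ge> C2 / (2 * \<eta>)" for T
  proof -
    \<comment> \<open>Since \<open>norm s1 \<le> T\<close>, the bound \<open>R \<ge> 4 * T\<close>
      puts the whole segment into the disc of radius \<open>R / 2\<close>.\<close>
    obtain R R' where R: "4 * T \<le> R" "R \<le> 4 * T + 1" "R < R'"
      and RZ: "\<And>z. F z = 0 \<Longrightarrow> norm z < R' \<Longrightarrow> norm z < R \<and> norm z * R' < R\<^sup>2"
      using zero_free_circle[OF F, of "4 * T"] T by auto
    have R1: "1 \<le> R" "0 < R" "R \<ge> r1" using R T by auto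
    define Z where "Z = {z. F z = 0 \<and> norm z < R'}"
    have ZR: "\<rho> \<in> Z \<Longrightarrow> norm \<rho> * R' < R\<^sup>2" "\<rho> \<in> Z \<Longrightarrow> norm \<rho> < R" for \<rho>
      using RZ by (auto simp: Z_def)
    have "\<exists>g. g holomorphic_on ball 0 R' \<and>
        (\<forall>z\<in>ball 0 R' - Z. F z = exp (g z) * (\<Prod>\<rho>\<in>Z. blaschke R \<rho> z powi (zorder F \<rho>)))"
      using ZR(1) by (rule meromorphic_blaschke_factorization[OF F R1(2) R(3) Z_def]) blast+
    then obtain g where g: "g holomorphic_on ball 0 R'"
      "\<And>z. z \<in> ball 0 R' - Z \<Longrightarrow> F z = exp (g z) * (\<Prod>\<rho>\<in>Z. blaschke R \<rho> z powi (zorder F \<rho>))"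
      by blast
    have finZ: "finite Z"
      by (rule finite_subset[OF _ finite_zeros_nicely_meromorphic[OF F, of R']]) (auto simp: Z_def)
    define m where "m = (\<lambda>\<rho>. real_of_int \<bar>zorder F \<rho>\<bar>)"
    define N where "N = (\<Sum>\<rho>\<in>Z. m \<rho>)"
    have N0: "N \<ge> 0" unfolding N_def m_def by (intro sum_nonneg) auto
    have "Z = {z. F z = 0 \<and> norm z \<le> R}" using RZ R(3) by (auto simp: Z_def intro: less_imp_le)
    hence "N = divisor_count F R" by (simp add: N_def m_def divisor_count_def)
    hence N: "N \<le> \<epsilon> * R" using r1(2) R1 by simp
    note N
    also have "\<dots> \<le> 1 * R" using \<epsilon> R1 by (intro mult_right_mono) auto
    finally have NR: "N \<le> R" by simp
    define I where "I = integral {0..2*pi} (\<lambda>\<theta>. \<bar>Re (g (of_real R * cis \<theta>))\<bar>)"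
    have "I = 4 * pi * proximity F R - 2 * pi * Re (g 0)"
      unfolding I_def by (rule proximity_eq_log_modulus[OF g(1) R1(2) R(3) finZ ZR(2) g(2)])
    also have "\<dots> \<le> 4 * pi * R ^ K + 2 * pi * \<bar>Re (g 0)\<bar>"
    proof -
      have "4 * pi * proximity F R \<le> 4 * pi * R ^ K" using r1(1) R1 by simp
      moreover have "2 * pi * (- Re (g 0)) \<le> 2 * pi * \<bar>Re (g 0)\<bar>" by (intro mult_left_mono) auto
      ultimately show ?thesis by linarith
    qed
    also have "\<bar>Re (g 0)\<bar> \<le> C + N * (ln R + C)"
      unfolding N_def m_def by (rule C(2)[OF R1(1) R(3) Z_def ZR(1) g]) 
    also have "\<dots> \<le> C + R * (R + C)"
      using NR N0 C(1) R1 ln_le_minus_one[of R] by (intro add_left_mono mult_mono) auto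
    also have "\<dots> \<le> (2 * C + 1) * R ^ 2"
    proof -
      have "1 \<le> R\<^sup>2" "R \<le> R\<^sup>2" using R1 by (auto intro: one_le_power self_le_power)
      hence "C * 1 \<le> C * R\<^sup>2" "C * R \<le> C * R\<^sup>2" using C(1) by (blast intro: mult_left_mono)+
      thus ?thesis by (simp add: algebra_simps power2_eq_square)
    qed
    also have "4 * pi * R ^ K + 2 * pi * ((2 * C + 1) * R ^ 2) \<le> 4 * pi * R ^ (K + 2) + 2 * pi * ((2 * C + 1) * R ^ (K + 2))"
      using R1 C(1) by (intro add_mono mult_left_mono power_increasing) auto
    finally have I: "I \<le> pi * (4 + 2 * (2 * C + 1)) * R ^ (K + 2)" by (simp add: algebra_simps)
    have gk: "norm ((deriv ^^ k) g s) \<le> C2 / R" if "norm s \<le> R / 2" for s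
    proof -
      have "norm ((deriv ^^ k) g s) \<le> fact k * 2 ^ (k + 1) / (pi * R ^ k) * I"
        unfolding I_def by (rule higher_deriv_le_integral_abs_Re[OF g(1) R1(2) R(3) that]) (simp add: k_def)
      also have "\<dots> \<le> fact k * 2 ^ (k + 1) / (pi * R ^ k) * (pi * (4 + 2 * (2 * C + 1)) * R ^ (K + 2))"
        using R1 by (intro mult_left_mono I) auto
      also have "\<dots> = C2 * (R ^ (K + 2) / R ^ k)"
        unfolding C2_def by simp
      also have "R ^ k = R ^ (K + 2) * R" by (simp add: k_def eval_nat_numeral)
      finally show ?thesis using R1 by simp
    qed
    define y where "y = (\<lambda>\<rho>. Im s1 - Im \<rho>)"
    define U where "U = (\<lambda>\<tau>. (C2 / R + fact k * 2 ^ k * \<epsilon>) + (\<Sum>\<rho>\<in>Z. fact k * m \<rho> * (1 / (1 + (\<tau> + y \<rho>)\<^sup>2))))"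
    \<comment> \<open>In the half-plane \<open>F\<close> equals \<open>c * exp (l s)\<close> and so
      is nonzero, whereas it is 0 at zeros and poles alike.\<close>
    have ReZ: "Re \<rho> \<le> \<sigma>" if "\<rho> \<in> Z" for \<rho>
    proof (rule ccontr)
      assume "\<not> Re \<rho> \<le> \<sigma>"
      thus False using eq[of \<rho>] that \<open>c \<noteq> 0\<close> by (auto simp: Z_def)
    qed
    have bound: "norm ((deriv ^^ k) l (s1 + \<i> * of_real \<tau>)) \<le> U \<tau>" if \<tau>: "\<tau> \<in> {0..T}" for \<tau>
    proof -
      define s where "s = s1 + \<i> * of_real \<tau>"
      have "norm s \<le> norm s1 + \<tau>" unfolding s_def using \<tau> norm_triangle_ineq[of s1 "\<i> * of_real \<tau>"]
        by (simp add: norm_mult)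
      hence s: "norm s \<le> R / 2" "Re s > \<sigma>" "Re s \<ge> \<sigma> + 1" using \<tau> T R s1 by (auto simp: s_def)
      have "norm ((deriv ^^ k) l s) \<le> norm ((deriv ^^ k) g s) +
         (\<Sum>\<rho>\<in>Z. fact k * real_of_int \<bar>zorder F \<rho>\<bar> * (1 / norm (s - \<rho>) ^ k + (2 / R) ^ k))"
      proof (rule norm_higher_deriv_log_le[OF g(1) R1(2) R(3) finZ ZR(1) ReZ l \<open>c \<noteq> 0\<close> _ _ s(2,1)])
        fix u assume u: "Re u > \<sigma>" "norm u < R'"
        have "u \<notin> Z" using ReZ[of u] u by auto
        thus "c * exp (l u) = exp (g u) * (\<Prod>\<rho>\<in>Z. blaschke R \<rho> u powi (zorder F \<rho>))"
          using g(2)[of u] eq[of u] u by simp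
      qed (simp_all add: k_def)
      also have "\<dots> \<le> C2 / R + (\<Sum>\<rho>\<in>Z. fact k * m \<rho> * (1 / (1 + (\<tau> + y \<rho>)\<^sup>2) + (2 / R) ^ k))"
      proof (intro add_mono gk s sum_mono)
        fix \<rho> assume \<rho>: "\<rho> \<in> Z"
        \<comment> \<open>The margin of 1 gives \<open>norm (s - \<rho>) \<ge> 1\<close>, so the
          exponent \<open>k\<close> may be lowered to 2. This leads to a kernel with integral at
          most \<open>pi\<close>, uniformly in \<rho> and \<open>T\<close>.\<close>
        have "1 \<le> Re (s - \<rho>)" using ReZ[OF \<rho>] s by simp
        hence "1\<^sup>2 \<le> (Re (s - \<rho>))\<^sup>2" by (intro power_mono) auto
        hence sq: "1 + (\<tau> + y \<rho>)\<^sup>2 \<le> norm (s - \<rho>) ^ 2"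
          unfolding cmod_power2 by (simp add: s_def y_def algebra_simps)
        have "1 \<le> norm (s - \<rho>)" using \<open>1 \<le> Re (s - \<rho>)\<close> complex_Re_le_cmod order_trans by blast
        hence "norm (s - \<rho>) ^ 2 \<le> norm (s - \<rho>) ^ k" by (intro power_increasing) (auto simp: k_def)
        with sq have "1 + (\<tau> + y \<rho>)\<^sup>2 \<le> norm (s - \<rho>) ^ k" by linarith
        hence "1 / norm (s - \<rho>) ^ k \<le> 1 / (1 + (\<tau> + y \<rho>)\<^sup>2)"
          by (intro divide_left_mono mult_pos_pos) (auto simp: add_pos_nonneg intro: order_less_le_trans[of 0 "1 + (\<tau> + y \<rho>)\<^sup>2"])
        thus "fact k * real_of_int \<bar>zorder F \<rho>\<bar> * (1 / norm (s - \<rho>) ^ k + (2 / R) ^ k)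
            \<le> fact k * m \<rho> * (1 / (1 + (\<tau> + y \<rho>)\<^sup>2) + (2 / R) ^ k)"
          unfolding m_def by (intro mult_left_mono add_right_mono) auto
      qed
      also have "\<dots> = C2 / R + fact k * N * (2 / R) ^ k + (\<Sum>\<rho>\<in>Z. fact k * m \<rho> * (1 / (1 + (\<tau> + y \<rho>)\<^sup>2)))"
        by (simp only: distrib_left sum.distrib N_def sum_distrib_right sum_distrib_left)
      also have "fact k * N * (2 / R) ^ k \<le> fact k * 2 ^ k * \<epsilon>"
      proof -
        have "R * 1 \<le> R * R ^ (k - 1)" using R1 by (intro mult_left_mono one_le_power) auto
        also have "\<dots> = R ^ k" by (simp add: k_def power_eq_if[of R "K+3"])
        finally have "N * 1 \<le> \<epsilon> * R ^ k" using N \<epsilon> by (simp add: order_trans[OF N] mult_left_mono)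
        hence "N / R ^ k \<le> \<epsilon>" using R1 by (simp add: field_simps)
        hence "fact k * 2 ^ k * (N / R ^ k) \<le> fact k * 2 ^ k * \<epsilon>" by (intro mult_left_mono) auto
        thus ?thesis by (simp add: power_divide mult_ac)
      qed
      finally show ?thesis unfolding s_def U_def by simp
    qed
    define V where "V = (\<Sum>\<rho>\<in>Z. fact k * m \<rho> * (arctan (T + y \<rho>) - arctan (y \<rho>)))"
    have intU: "(U has_integral ((T - 0) *\<^sub>R (C2 / R + fact k * 2 ^ k * \<epsilon>) + V)) {0..T}"
      unfolding U_def V_def
      by (intro has_integral_add has_integral_sum finZ has_integral_mult_right has_integral_inverse_one_plus_square)
         (use T has_integral_const_real[of "C2 / R + fact k * 2 ^ k * \<epsilon>" 0 T] in simp_all)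
    have "continuous_on {s. Re s > \<sigma>} ((deriv ^^ k) l)"
      by (intro holomorphic_on_imp_continuous_on holomorphic_higher_deriv l open_halfspace_Re_gt)
    moreover have "continuous_on {0..T} (\<lambda>\<tau>. s1 + \<i> * of_real \<tau>)" by (intro continuous_intros)
    ultimately have "continuous_on {0..T} (\<lambda>\<tau>. (deriv ^^ k) l (s1 + \<i> * of_real \<tau>))"
      by (rule continuous_on_compose2) (use s1 in auto)
    hence cont: "continuous_on {0..T} (\<lambda>\<tau>. norm ((deriv ^^ k) l (s1 + \<i> * of_real \<tau>)))"
      by (rule continuous_on_norm)
    have "integral {0..T} (\<lambda>\<tau>. norm ((deriv ^^ k) l (s1 + \<i> * of_real \<tau>))) \<le> integral {0..T} U"
      by (rule integral_le[OF integrable_continuous_interval[OF cont] has_integral_integrable[OF intU] bound])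
    also have "\<dots> = T * (C2 / R) + T * (fact k * 2 ^ k * \<epsilon>) + V"
      using integral_unique[OF intU] by (simp add: algebra_simps)
    also have "V \<le> (\<Sum>\<rho>\<in>Z. fact k * m \<rho> * pi)"
      unfolding V_def
    proof (intro sum_mono mult_left_mono)
      fix \<rho> show "arctan (T + y \<rho>) - arctan (y \<rho>) \<le> pi"
        using arctan_ubound[of "T + y \<rho>"] arctan_lbound[of "y \<rho>"] by linarith
    qed (auto simp: m_def)
    also have "\<dots> = fact k * pi * N" by (simp add: N_def sum_distrib_left mult_ac)
    also have "\<dots> \<le> fact k * pi * (\<epsilon> * (5 * T))"
    proof (intro mult_left_mono)
      have "\<epsilon> * R \<le> \<epsilon> * (5 * T)" using R T \<epsilon> by (intro mult_left_mono) auto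
      thus "N \<le> \<epsilon> * (5 * T)" using N by linarith
    qed auto
    also have "T * (C2 / R) \<le> C2 / 4"
    proof -
      have "T * C2 \<le> R / 4 * C2" using R C2 by (intro mult_right_mono) auto
      thus ?thesis using R1 by (simp add: field_simps)
    qed
    also have "C2 / 4 + T * (fact k * 2 ^ k * \<epsilon>) + fact k * pi * (\<epsilon> * (5 * T)) = C2 / 4 + T * (\<epsilon> * D)"
      by (simp add: D_def algebra_simps)
    \<comment> \<open>One half of \<eta> absorbs the bounded part, by
      \<open>T \<ge> C2 / (2 * \<eta>)\<close>; the other half absorbs
      \<open>\<epsilon> * D\<close>.\<close>
    also have "\<dots> \<le> \<eta> / 2 * T + T * (\<eta> / 2)"
    proof (intro add_mono mult_left_mono \<epsilon>(3))
      show "C2 / 4 \<le> \<eta> / 2 * T" using T(4) \<open>\<eta> > 0\<close> by (simp add: field_simps)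
    qed (use T in auto)
    also have "\<dots> = \<eta> * T" by simp
    finally show ?thesis by simp
  qed
  show ?thesis unfolding k_def[symmetric]
    by (rule eventually_mono[OF eventually_ge_at_top[of "max (max 1 r1) (max (norm s1) (C2 / (2 * \<eta>)))"]]) (rule main; simp)
qed

section \<open>From sparse zeros and poles to a constant function\<close>

theorem theorem1p1:
  fixes a :: "nat \<Rightarrow> complex" and lam :: "nat \<Rightarrow> real" and b :: real
    and f F :: "complex \<Rightarrow> complex" and c :: complex
  assumes unif: "uniform_limit {s. Re s > b}
                   (\<lambda>M s. \<Sum>n<M. a n * exp (of_real (lam n) * s)) f sequentially"
    and mero: "F nicely_meromorphic_on UNIV"
    and cont: "\<And>s. Re s > b \<Longrightarrow> F s = f s"
    and nonconst: "\<not> (\<exists>k. \<forall>s. F s = k)"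
    and finite_order: "nevanlinna_order F < \<infinity>"
    and lim: "(f \<longlongrightarrow> c) (filtercomap Re at_top)"
    and c_nz: "c \<noteq> 0"
  shows "Limsup at_top (\<lambda>r. ereal ((N_a F 0 r + N_poles F r) / r)) > 0"
proof (rule ccontr)
  assume "\<not> ?thesis"
  hence sparse: "eventually (\<lambda>r. divisor_count F r \<le> \<epsilon> * r) at_top" if "\<epsilon> > 0" for \<epsilon>
    using eventually_divisor_count_le[OF mero nonconst _ that] by simp
  obtain K where K: "eventually (\<lambda>r. proximity F r \<le> r ^ K) at_top"
    using eventually_proximity_le_power[OF mero nonconst finite_order] .
  have "eventually (\<lambda>s. dist (f s) c < norm c / 2) (filtercomap Re at_top)"
    using tendstoD[OF lim, of "norm c / 2"] c_nz by simp
  then obtain X where X: "\<And>s. Re s \<ge> X \<Longrightarrow> dist (f s) c < norm c / 2"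
    by (auto simp: eventually_filtercomap eventually_at_top_linorder)
  \<comment> \<open>To the right of \<sigma> the series represents \<open>F\<close>, and
    \<open>F / c\<close> stays in the ball of radius 1/2 about 1, where \<open>Ln\<close> is
    holomorphic and Lipschitz.\<close>
  define \<sigma> where "\<sigma> = max b X"
  define W where "W = {s. Re s > \<sigma>}"
  define q where "q = (\<lambda>s. F s / c)"
  define l where "l = (\<lambda>s. Ln (q s))"
  have Ff: "F s = f s" if "s \<in> W" for s using that cont by (simp add: W_def \<sigma>_def)
  have q: "q s \<in> ball 1 (1/2)" if "s \<in> W" for s
  proof -
    have "norm (F s - c) < norm c / 2" using X[of s] Ff[OF that] that by (simp add: dist_norm W_def \<sigma>_def)
    moreover have "norm (1 - q s) = norm (F s - c) / norm c"
      using c_nz by (simp add: q_def norm_divide[symmetric] diff_divide_distrib norm_minus_commute)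
    ultimately show ?thesis using c_nz by (simp add: dist_norm pos_divide_less_eq)
  qed
  have q_pos: "Re (q s) > 0" if "s \<in> W" for s
    using complex_Re_le_cmod[of "1 - q s"] q[OF that] by (simp add: dist_norm)
  have F_nz: "F s \<noteq> 0" if "s \<in> W" for s using q_pos[OF that] by (auto simp: q_def)
  \<comment> \<open>A nonzero value rules out a pole, because the representative is 0 at its
    poles.\<close>
  have "F analytic_on {s}" if "s \<in> W" for s
    using F_nz[OF that] is_pole_zero_at_nicely_mero[OF mero, of s] nicely_meromorphic_on_imp_analytic_at[OF mero, of s] by auto
  hence "F holomorphic_on W" by (meson analytic_imp_holomorphic analytic_on_analytic_at)
  hence "l holomorphic_on W"
    unfolding l_def q_def using q_pos c_nz
    by (intro holomorphic_intros) (force simp: q_def complex_nonpos_Reals_iff)+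
  hence l: "l holomorphic_on {s. Re s > \<sigma>}" by (simp add: W_def)
  have exp_l: "c * exp (l s) = F s" if "Re s > \<sigma>" for s
    using F_nz[of s] that c_nz by (simp add: l_def q_def W_def)
  have mean: "eventually (\<lambda>T. integral {0..T} (\<lambda>\<tau>. norm ((deriv ^^ (K + 3)) l (s1 + \<i> * of_real \<tau>))) \<le> \<eta> * T) at_top"
    if "\<eta> > 0" "Re s1 \<ge> \<sigma> + 1" for \<eta> s1
    by (rule higher_deriv_log_mean_zero[OF mero nonconst K sparse l c_nz exp_l]) (use that in auto)
  have ap: "\<exists>S. finite S \<and> (\<forall>\<tau>. \<exists>\<nu>\<in>S. \<forall>s. \<sigma> < Re s \<longrightarrow> Re s \<le> B \<longrightarrow>
          norm (l (s + \<i> * of_real (\<tau> - \<nu>)) - l s) \<le> \<epsilon>)" if "\<epsilon> > 0" for \<epsilon> B :: real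
  proof -
    \<comment> \<open>The tolerance compensates for the division by \<open>c\<close> and the
      Lipschitz constant 2 of \<open>Ln\<close>.\<close>
    have "\<epsilon> * norm c / 2 > 0" using that c_nz by simp
    then obtain S where S: "finite S" "\<And>\<tau>. \<exists>\<nu>\<in>S. \<forall>s. b < Re s \<longrightarrow> Re s \<le> B \<longrightarrow>
        norm (f (s + \<i> * of_real (\<tau> - \<nu>)) - f s) < \<epsilon> * norm c / 2"
      by (rule almost_periodic_strip[OF unif]) blast
    have "norm (l (s + \<i> * of_real t) - l s) \<le> \<epsilon>"
      if "\<sigma> < Re s" "norm (f (s + \<i> * of_real t) - f s) < \<epsilon> * norm c / 2" for s t
    proof -
      have sW: "s + \<i> * of_real t \<in> W" "s \<in> W" using that by (auto simp: W_def)
      have "norm (l (s + \<i> * of_real t) - l s) \<le> 2 * norm (q (s + \<i> * of_real t) - q s)"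
        unfolding l_def by (intro Ln_Lipschitz_near_1 q sW)
      also have "\<dots> = 2 * norm (f (s + \<i> * of_real t) - f s) / norm c"
        using Ff[OF sW(1)] Ff[OF sW(2)] by (simp add: q_def norm_divide diff_divide_distrib[symmetric])
      also have "\<dots> \<le> \<epsilon>" using that(2) c_nz by (simp add: field_simps)
      finally show ?thesis .
    qed
    moreover have "b < Re s" if "\<sigma> < Re s" for s :: complex using that by (simp add: \<sigma>_def)
    ultimately show ?thesis using S by meson
  qed
  \<comment> \<open>The margin of 1 to the right of \<sigma> is what both the Cauchy estimate and
    the bound on the means ask for.\<close>
  have zero: "(deriv ^^ (K + 3)) l s = 0" if "Re s > \<sigma> + 1" for s
  proof (rule higher_deriv_almost_periodic_mean_zero[OF l ap mean that])
  qed (use that in auto)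
  have "(l \<longlongrightarrow> 0) (filtercomap Re at_top)"
  proof -
    have "eventually (\<lambda>s. Re s > b) (filtercomap Re at_top)"
      by (intro eventually_filtercomapI eventually_gt_at_top)
    hence "eventually (\<lambda>s. f s = F s) (filtercomap Re at_top)"
      by eventually_elim (use cont in auto)
    hence "(F \<longlongrightarrow> c) (filtercomap Re at_top)" using lim tendsto_cong by blast
    hence "(q \<longlongrightarrow> 1) (filtercomap Re at_top)"
      unfolding q_def using c_nz tendsto_divide[of F c _ "\<lambda>_. c" c] by simp
    thus ?thesis unfolding l_def using tendsto_Ln[of q 1] by simp
  qed
  hence "l s = 0" if "Re s > \<sigma> + 1" for s
    using that zero by (intro holomorphic_zero_if_higher_deriv_zero[of l "\<sigma> + 1" "K + 3"] holomorphic_on_subset[OF l]) auto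
  hence Fc: "F s = c" if "Re s > \<sigma> + 1" for s using exp_l[of s] that by auto
  \<comment> \<open>A point inside the half-plane on which \<open>F\<close> equals \<open>c\<close>;
    from there the identity theorem spreads the equality over the plane.\<close>
  define z where "z = complex_of_real (\<sigma> + 2)"
  have "eventually (\<lambda>s. s \<in> {s. Re s > \<sigma> + 1}) (at z)"
    by (intro eventually_at_in_open' open_halfspace_Re_gt) (simp add: z_def)
  hence "eventually (\<lambda>s. F s = c) (at z)" by eventually_elim (simp add: Fc)
  hence "frequently (\<lambda>s. F s = c) (at z)" by (intro eventually_frequently) auto
  hence "F w = c" for w
    by (rule frequently_eq_meromorphic_imp_constant[OF _ mero open_UNIV connected_UNIV]) auto
  thus False using nonconst by blast
qed

end
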